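(* There exist universal numerical constants $c_{\mathrm{end}},c_{\mathrm{acc}}^{\mathrm{end}}>0$ such that, for every $L,\tau,\Delta_0,\sigma^2>0$ satisfying $L\tau\ge1/2$ and every $0<\varepsilon\le c_{\mathrm{acc}}^{\mathrm{end}}\Delta_0$, the gradient-only bounded-variance oracle complexity over the globally $L$-smooth, globally Polyak–Łojasiewicz class satisfies $$T_\varepsilon^{\mathrm{BV,glob}}(L,\tau,\Delta_0,\sigma^2)\ \ge\ c_{\mathrm{end}}\,\frac{L\tau^2\sigma^2}{\varepsilon}.$$ One may take $c_{\mathrm{acc}}^{\mathrm{end}}=1/10$.
   Context: $\|\cdot\|$ is the Euclidean norm; for $f:\mathbb{R}^d\to\mathbb{R}$, $f_\star:=\inf_{x\in\mathbb{R}^d} f(x)$. Function class. $\mathcal F^{\mathrm{glob}}_{2,L,\tau,\Delta_0}(0)$ is the set (over all dimensions $d\ge1$) of differentiable $f:\mathbb{R}^d\to\mathbb{R}$ with $f_\star>-\infty$, $f(0)-f_\star\le\Delta_0$, $\nabla f$ globally $L$-Lipschitz on $\mathbb{R}^d$, and $f(x)-f_\star\le\tau\|\nabla f(x)\|^2$ for every $x\in\mathbb{R}^d$. Bounded-variance oracle. For differentiable $f:\mathbb{R}^d\to\mathbb{R}$, $\mathfrak O_{\sigma^2}(f)$ is the set of stochastic gradient oracles $G$ such that each query at a point $x$ returns a fresh sample $G(x,\xi)$ with $\mathbb{E}[G(x,\xi)\mid x]=\nabla f(x)$ and $\mathbb{E}[\|G(x,\xi)-\nabla f(x)\|^2\mid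 x]\le\sigma^2$ for all $x\in\mathbb{R}^d$. The algorithm receives only samples of $G$, no function values. Stochastic first-order methods. A randomized stochastic first-order method is a family $A=(A_d)_{d\ge1}$. On $f:\mathbb{R}^d\to\mathbb{R}$ and $G\in\mathfrak O_{\sigma^2}(f)$ it starts from $x_0=0$, and each query $x_t$ is measurable with respect to the past transcript $\{G(x_s,\xi_s):0\le s<t\}$ and the method's internal randomness. $x_T^A(f,G)$ denotes the point returned after $T$ oracle calls. Define $$\mathcal E_T^{\mathrm{BV,glob}}:=\inf_A\ \sup_{f\in\mathcal F^{\mathrm{glob}}_{2,L,\tau,\Delta_0}(0)}\ \sup_{G\in\mathfrak O_{\sigma^2}(f)}\mathbb{E}\bigl[f(x_T^A(f,G))-f_\star\bigr]$$ (the first supremum ranges over all dimensions; expectation over oracle and algorithmic randomness), and $T_\varepsilon^{\mathrm{BV,glob}}(L,\tau,\Delta_0,\sigma^2):=\inf\{T\ge0\ (T\text{ integer}):\mathcal E_T^{\mathrm{BV,glob}}\le\varepsilon\}$. *)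

theory Defs
  imports "HOL-Probability.Probability"
begin

text \<open>
  The dimension is quantified inside the minimax risk, so it is a natural number and not a
  type: a vector of \<open>\<real>\<^sup>d\<close> is a function on \<open>{..<d}\<close>, extended by
  \<^const>\<open>undefined\<close>. The product \<open>\<sigma>\<close>-algebra on these functions is the Borel
  \<open>\<sigma>\<close>-algebra of \<open>\<real>\<^sup>d\<close>, and \<^const>\<open>L2_set\<close> over
  \<open>{..<d}\<close> is the Euclidean norm.
\<close>

type_synonym vect = "nat \<Rightarrow> real"

abbreviation Rn :: "nat \<Rightarrow> vect set" where
  "Rn d \<equiv> {..<d} \<rightarrow>\<^sub>E UNIV"

abbreviation borel_Rn :: "nat \<Rightarrow> vect measure" where
  "borel_Rn d \<equiv> Pi\<^sub>M {..<d} (\<lambda>_. borel)"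

definition zero_Rn :: "nat \<Rightarrow> vect" where
  "zero_Rn d = (\<lambda>i\<in>{..<d}. 0)"

definition norm_Rn :: "nat \<Rightarrow> vect \<Rightarrow> real" where
  "norm_Rn d x = L2_set x {..<d}"

definition dist_Rn :: "nat \<Rightarrow> vect \<Rightarrow> vect \<Rightarrow> real" where
  "dist_Rn d x y = norm_Rn d (\<lambda>i. x i - y i)"

text \<open>Frechet differentiability at \<open>x\<close> with gradient \<open>g\<close>.\<close>

definition has_gradient :: "nat \<Rightarrow> (vect \<Rightarrow> real) \<Rightarrow> vect \<Rightarrow> vect \<Rightarrow> bool" where
  "has_gradient d f x g \<longleftrightarrow> g \<in> Rn d \<and>
     (\<forall>e>0. \<exists>\<delta>>0. \<forall>y\<in>Rn d. dist_Rn d y x < \<delta> \<longrightarrow>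
        \<bar>f y - f x - (\<Sum>i<d. g i * (y i - x i))\<bar> \<le> e * dist_Rn d y x)"

definition differentiable_Rn :: "nat \<Rightarrow> (vect \<Rightarrow> real) \<Rightarrow> bool" where
  "differentiable_Rn d f \<longleftrightarrow> (\<forall>x\<in>Rn d. \<exists>g. has_gradient d f x g)"

definition grad :: "nat \<Rightarrow> (vect \<Rightarrow> real) \<Rightarrow> vect \<Rightarrow> vect" where
  "grad d f x = (THE g. has_gradient d f x g)"

definition inf_val :: "nat \<Rightarrow> (vect \<Rightarrow> real) \<Rightarrow> real" where
  "inf_val d f = (INF x\<in>Rn d. f x)"

definition PL_class :: "real \<Rightarrow> real \<Rightarrow> real \<Rightarrow> nat \<Rightarrow> (vect \<Rightarrow> real) set" where
  "PL_class L \<tau> \<Delta>\<^sub>0 d = {f.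
     differentiable_Rn d f \<and>
     bdd_below (f ` Rn d) \<and>
     f (zero_Rn d) - inf_val d f \<le> \<Delta>\<^sub>0 \<and>
     (\<forall>x\<in>Rn d. \<forall>y\<in>Rn d. dist_Rn d (grad d f x) (grad d f y) \<le> L * dist_Rn d x y) \<and>
     (\<forall>x\<in>Rn d. f x - inf_val d f \<le> \<tau> * (norm_Rn d (grad d f x))\<^sup>2)}"

text \<open>
  Noise and internal randomness are carried by the type of reals, with an arbitrary probability
  measure on an arbitrary \<open>\<sigma>\<close>-algebra. This covers every standard Borel probability
  space, and such spaces realise every Markov kernel into some \<open>\<real>\<^sup>d\<close>.
\<close>

record grad_oracle =
  noise :: "real measure"
  sample :: "vect \<Rightarrow> real \<Rightarrow> vect"

definition BV_oracles :: "real \<Rightarrow> nat \<Rightarrow> (vect \<Rightarrow> real) \<Rightarrow> grad_oracle set" where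
  "BV_oracles v d f = {G.
     prob_space (noise G) \<and>
     (\<lambda>(x, \<xi>). sample G x \<xi>) \<in> borel_Rn d \<Otimes>\<^sub>M noise G \<rightarrow>\<^sub>M borel_Rn d \<and>
     (\<forall>x\<in>Rn d.
        (\<forall>i<d. integrable (noise G) (\<lambda>\<xi>. sample G x \<xi> i) \<and>
               (\<integral>\<xi>. sample G x \<xi> i \<partial>noise G) = grad d f x i) \<and>
        (\<integral>\<^sup>+\<xi>. ennreal ((dist_Rn d (sample G x \<xi>) (grad d f x))\<^sup>2) \<partial>noise G) \<le> ennreal v)}"

text \<open>
  \<open>query A d t r h\<close> is the point \<open>x\<^sub>t\<close> chosen in dimension \<open>d\<close> from
  the seed \<open>r\<close> and the transcript \<open>h\<close>, a function on \<open>{..<t}\<close> whose value at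
  \<open>s\<close> is the sample received at \<open>x\<^sub>s\<close>. Infinitely many random bits can be read off
  one real seed, so a single seed drawn at the start is no restriction.
\<close>

record sfo_method =
  seed :: "nat \<Rightarrow> real measure"
  query :: "nat \<Rightarrow> nat \<Rightarrow> real \<Rightarrow> (nat \<Rightarrow> vect) \<Rightarrow> vect"

definition sfo_methods :: "sfo_method set" where
  "sfo_methods = {A. \<forall>d\<ge>1.
     prob_space (seed A d) \<and>
     (\<forall>t. (\<lambda>(r, h). query A d t r h)
        \<in> seed A d \<Otimes>\<^sub>M Pi\<^sub>M {..<t} (\<lambda>_. borel_Rn d) \<rightarrow>\<^sub>M borel_Rn d) \<and>
     (\<forall>r h. query A d 0 r h = zero_Rn d)}"

primrec transcript ::
  "sfo_method \<Rightarrow> nat \<Rightarrow> grad_oracle \<Rightarrow> real \<Rightarrow> (nat \<Rightarrow> real) \<Rightarrow> nat \<Rightarrow> nat \<Rightarrow> vect" where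
  "transcript A d G r \<xi> 0 = (\<lambda>_. undefined)"
| "transcript A d G r \<xi> (Suc t) =
     (transcript A d G r \<xi> t)(t := sample G (query A d t r (transcript A d G r \<xi> t)) (\<xi> t))"

definition iterate ::
  "sfo_method \<Rightarrow> nat \<Rightarrow> grad_oracle \<Rightarrow> nat \<Rightarrow> real \<Rightarrow> (nat \<Rightarrow> real) \<Rightarrow> vect" where
  "iterate A d G t r \<xi> = query A d t r (transcript A d G r \<xi> t)"

text \<open>
  The seed and the noise variables \<open>\<xi> 0, \<dots>, \<xi> (T - 1)\<close> are independent. The
  expectation is a nonnegative integral, so a non-integrable gap counts as \<open>\<infinity>\<close>.
\<close>

definition expected_gap ::
  "sfo_method \<Rightarrow> nat \<Rightarrow> (vect \<Rightarrow> real) \<Rightarrow> grad_oracle \<Rightarrow> nat \<Rightarrow> ennreal" where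
  "expected_gap A d f G T =
     (\<integral>\<^sup>+(r, \<xi>). ennreal (f (iterate A d G T r \<xi>) - inf_val d f)
        \<partial>(seed A d \<Otimes>\<^sub>M Pi\<^sub>M {..<T} (\<lambda>_. noise G)))"

definition minimax_gap :: "real \<Rightarrow> real \<Rightarrow> real \<Rightarrow> real \<Rightarrow> nat \<Rightarrow> ennreal" where
  "minimax_gap L \<tau> \<Delta>\<^sub>0 v T =
     (INF A\<in>sfo_methods. SUP d\<in>{1..}. SUP f\<in>PL_class L \<tau> \<Delta>\<^sub>0 d. SUP G\<in>BV_oracles v d f.
        expected_gap A d f G T)"

text \<open>The infimum is taken in \<^typ>\<open>ereal\<close>, so it is \<open>\<infinity>\<close> when no \<open>T\<close> qualifies.\<close>

definition oracle_complexity :: "real \<Rightarrow> real \<Rightarrow> real \<Rightarrow> real \<Rightarrow> real \<Rightarrow> ereal" where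
  "oracle_complexity \<epsilon> L \<tau> \<Delta>\<^sub>0 v =
     (INF T\<in>{T. minimax_gap L \<tau> \<Delta>\<^sub>0 v T \<le> ennreal \<epsilon>}. ereal (real T))"

end

theory Submission
  imports Defs
begin

text \<open>
  Write the gradient as \<open>q + h\<close>, where \<open>q\<close> carries no information that is still hidden and
  \<open>h\<close> is bounded, and let the oracle return \<open>q + (b / p) * h\<close> with \<open>b\<close> a Bernoulli variable of
  mean \<open>p\<close>, where \<open>p\<close> is of order \<open>\<bar>h\<bar>\<^sup>2 / \<sigma>\<^sup>2\<close>. Only about \<open>p * T\<close> of the \<open>T\<close> answers then
  reveal anything.

  The hard instance is a chain of \<open>K\<close> stages, \<open>K\<close> of order \<open>L * \<tau>\<close>. Stage \<open>k\<close> moves a block of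
  \<open>M\<close> coordinates from \<open>0\<close> to a unit vector \<open>e\<^bsub>\<iota> k\<^esub>\<close> with hidden index \<open>\<iota> k\<close>, and it acts only
  once the previous block has been moved. An informative answer reveals one new index, and for
  large \<open>M\<close> guessing an index is hopeless, so the average gap stays of order \<open>\<epsilon>\<close> until \<open>K / 2\<close>
  answers were informative. The Polyak-Lojasiewicz inequality holds since at any point the first
  unfinished stage alone contributes a gradient of constant norm, while the gap is of order \<open>K\<close>.
  With \<open>\<bar>h\<bar>\<^sup>2\<close> of order \<open>\<epsilon> / \<tau>\<close> this gives \<open>T\<close> of order
  \<open>K / p = L * \<tau>\<^sup>2 * \<sigma>\<^sup>2 / \<epsilon>\<close>. For bounded \<open>L * \<tau>\<close> two quadratics with opposite hidden
  minimisers suffice.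
\<close>

section \<open>Gradients along lines\<close>

lemma dist_Rn_eq: "dist_Rn d x y = L2_set (\<lambda>i. x i - y i) {..<d}"
  by (simp add: dist_Rn_def norm_Rn_def)

lemma L2_set_scale: "L2_set (\<lambda>i. c * f i) A = \<bar>c\<bar> * L2_set f A"
  by (simp add: L2_set_def power_mult_distrib sum_distrib_left[symmetric] real_sqrt_mult)

lemma L2_set_power2: "(L2_set f A)\<^sup>2 = (\<Sum>i\<in>A. (f i)\<^sup>2)"
  by (simp add: L2_set_def sum_nonneg)

lemma sum_mult_le_L2_set: "\<bar>\<Sum>i\<in>A. f i * g i\<bar> \<le> L2_set f A * L2_set g A"
proof -
  have "\<bar>\<Sum>i\<in>A. f i * g i\<bar> \<le> (\<Sum>i\<in>A. \<bar>f i\<bar> * \<bar>g i\<bar>)"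
    using sum_abs[of "\<lambda>i. f i * g i" A] by (simp add: abs_mult)
  also have "\<dots> \<le> L2_set f A * L2_set g A" by (rule L2_set_mult_ineq)
  finally show ?thesis .
qed

text \<open>Shifting only coordinate \<open>j\<close> by a small \<open>h\<close>, both candidates
  predict the increment of \<open>f\<close> up to \<open>e/2 * h\<close>, so their
  \<open>j\<close>-th entries differ by at most \<open>e\<close>. This makes the description in
  \<open>grad\<close> well defined.\<close>

lemma has_gradient_unique:
  assumes "has_gradient d f x g" "has_gradient d f x g'" "x \<in> Rn d"
  shows "g = g'"
proof (rule PiE_ext)
  show "g \<in> Rn d" "g' \<in> Rn d" using assms by (auto simp: has_gradient_def)
  fix j assume j: "j \<in> {..<d}"
  have "\<bar>g j - g' j\<bar> \<le> 0 + e" if e: "e > 0" for e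
  proof -
    from e have e2: "e/2 > 0" by simp
    obtain a where a: "a > 0" "\<And>y. y \<in> Rn d \<Longrightarrow> dist_Rn d y x < a \<Longrightarrow>
        \<bar>f y - f x - (\<Sum>i<d. g i * (y i - x i))\<bar> \<le> e/2 * dist_Rn d y x"
      using assms(1) e2 unfolding has_gradient_def by meson
    obtain b where b: "b > 0" "\<And>y. y \<in> Rn d \<Longrightarrow> dist_Rn d y x < b \<Longrightarrow>
        \<bar>f y - f x - (\<Sum>i<d. g' i * (y i - x i))\<bar> \<le> e/2 * dist_Rn d y x"
      using assms(2) e2 unfolding has_gradient_def by meson
    define h where "h = min a b / 2"
    have h: "h > 0" "h < a" "h < b" using a b by (auto simp: h_def)
    define y where "y = x(j := x j + h)"
    have y: "y \<in> Rn d" using assms(3) j by (auto simp: y_def PiE_def extensional_def)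
    have yx: "y i - x i = (if i = j then h else 0)" for i by (simp add: y_def)
    have dy: "dist_Rn d y x = h"
      using j h(1) by (simp add: dist_Rn_eq yx L2_set_def if_distrib[of "\<lambda>z. z\<^sup>2"] cong: if_cong)
    have s: "(\<Sum>i<d. G i * (y i - x i)) = G j * h" for G :: vect
      using j by (simp add: yx if_distrib cong: if_cong)
    have "\<bar>f y - f x - g j * h\<bar> \<le> e/2 * h" "\<bar>f y - f x - g' j * h\<bar> \<le> e/2 * h"
      using a(2)[OF y] b(2)[OF y] h by (simp_all add: dy s)
    then have "\<bar>g j * h - g' j * h\<bar> \<le> e / 2 * h + e / 2 * h" by linarith
    then have "\<bar>(g j - g' j) * h\<bar> \<le> e * h" by (simp add: left_diff_distrib)
    then show ?thesis using h(1) by (simp add: abs_mult)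
  qed
  then have "\<bar>g j - g' j\<bar> \<le> 0" by (rule field_le_epsilon)
  then show "g j = g' j" by simp
qed

text \<open>By the mean value theorem on the segment from \<open>x\<close> to \<open>y\<close>, the
  increment is the directional derivative at an intermediate point; the Lipschitz bound moves it
  back to \<open>x\<close> at a cost of at most \<open>L\<close> times the squared distance.\<close>

lemma has_gradientI:
  assumes line: "\<And>x v t. ((\<lambda>t. F (\<lambda>i. x i + t * v i)) has_real_derivative
      (\<Sum>n<d. g (\<lambda>i. x i + t * v i) n * v n)) (at t)"
    and lip: "\<And>x y. L2_set (\<lambda>n. g x n - g y n) {..<d} \<le> L * L2_set (\<lambda>n. x n - y n) {..<d}"
    and L: "L \<ge> 0"
  shows "has_gradient d F x (restrict (g x) {..<d})"
  unfolding has_gradient_def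
proof (intro conjI allI impI)
  fix e :: real assume e: "e > 0"
  show "\<exists>\<delta>>0. \<forall>y\<in>Rn d. dist_Rn d y x < \<delta> \<longrightarrow>
     \<bar>F y - F x - (\<Sum>i<d. restrict (g x) {..<d} i * (y i - x i))\<bar> \<le> e * dist_Rn d y x"
  proof (intro exI[of _ "e / (L + 1)"] conjI ballI impI)
    show "e / (L + 1) > 0" using e L by simp
    fix y assume dy: "dist_Rn d y x < e / (L + 1)"
    define v where "v = (\<lambda>i. y i - x i)"
    define D where "D = dist_Rn d y x"
    have Dv: "L2_set v {..<d} = D" by (simp add: D_def dist_Rn_eq v_def)
    have D0: "D \<ge> 0" by (simp add: Dv[symmetric])
    let ?p = "\<lambda>t i. x i + t * v i"
    have p01: "?p 0 = x" "?p 1 = y" by (auto simp: v_def)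
    obtain z where z: "0 < z" "z < 1"
      "F (?p 1) - F (?p 0) = (1 - 0) * (\<Sum>n<d. g (?p z) n * v n)"
      using MVT2[of 0 1 "\<lambda>t. F (?p t)" "\<lambda>t. \<Sum>n<d. g (?p t) n * v n"] line by auto
    have "F y - F x - (\<Sum>i<d. restrict (g x) {..<d} i * (y i - x i))
      = (\<Sum>n<d. (g (?p z) n - g x n) * v n)"
      using z(3) by (simp add: p01 v_def sum_subtractf left_diff_distrib)
    also have "\<bar>\<dots>\<bar> \<le> L2_set (\<lambda>n. g (?p z) n - g x n) {..<d} * D"
      unfolding Dv[symmetric] by (rule sum_mult_le_L2_set)
    also have "\<dots> \<le> (L * L2_set (\<lambda>n. ?p z n - x n) {..<d}) * D"
      by (intro mult_right_mono lip D0)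
    also have "L2_set (\<lambda>n. ?p z n - x n) {..<d} = z * D"
      using z by (simp add: L2_set_scale Dv)
    also have "L * (z * D) * D \<le> (L + 1) * D * D"
      using z L D0 by (intro mult_right_mono) (auto intro!: mult_mono simp: mult_left_le_one_le mult_le_one)
    also have "(L + 1) * D \<le> e" using dy L by (simp add: D_def field_simps)
    then have "(L + 1) * D * D \<le> e * D" using D0 by (intro mult_right_mono)
    finally show "\<bar>F y - F x - (\<Sum>i<d. restrict (g x) {..<d} i * (y i - x i))\<bar>
        \<le> e * dist_Rn d y x" by (simp add: D_def)
  qed
qed auto

lemma grad_eqI: "has_gradient d f x g \<Longrightarrow> x \<in> Rn d \<Longrightarrow> grad d f x = g"
  unfolding grad_def by (blast intro: has_gradient_unique)

lemma inf_val_eqI: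
  assumes "\<And>x. m \<le> F x" "x0 \<in> Rn d" "F x0 = m"
  shows "inf_val d F = m"
  unfolding inf_val_def using assms by (intro cInf_eq_minimum) auto

text \<open>\<open>F\<close> and \<open>g\<close> are controlled on all functions and not only on
  \<open>Rn d\<close>, because the points of a line \<open>x + t * v\<close> need not be
  extensional. \<open>m\<close> is the minimum of \<open>F\<close>, attained at
  \<open>x0\<close>.\<close>

lemma PL_class_lineI:
  assumes line: "\<And>x v t. ((\<lambda>t. F (\<lambda>i. x i + t * v i)) has_real_derivative
      (\<Sum>n<d. g (\<lambda>i. x i + t * v i) n * v n)) (at t)"
    and lip: "\<And>x y. L2_set (\<lambda>n. g x n - g y n) {..<d} \<le> L * L2_set (\<lambda>n. x n - y n) {..<d}"
    and L: "L \<ge> 0"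
    and m: "\<And>x. m \<le> F x" "x0 \<in> Rn d" "F x0 = m"
    and init: "F (zero_Rn d) - m \<le> \<Delta>"
    and PL: "\<And>x. F x - m \<le> \<tau> * (\<Sum>n<d. (g x n)\<^sup>2)"
  shows "F \<in> PL_class L \<tau> \<Delta> d"
    and "\<And>x. x \<in> Rn d \<Longrightarrow> grad d F x = restrict (g x) {..<d}"
proof -
  have hg: "has_gradient d F x (restrict (g x) {..<d})" for x
    by (rule has_gradientI[OF line lip L])
  show gr: "grad d F x = restrict (g x) {..<d}" if "x \<in> Rn d" for x
    using hg that by (rule grad_eqI)
  have iv: "inf_val d F = m" using m by (rule inf_val_eqI)
  have "L2_set (restrict h {..<d}) {..<d} = L2_set h {..<d}" for h :: vect
    by (intro L2_set_cong) auto
  moreover have "L2_set (\<lambda>i. restrict h {..<d} i - restrict k {..<d} i) {..<d} =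
      L2_set (\<lambda>i. h i - k i) {..<d}" for h k :: vect
    by (intro L2_set_cong) auto
  moreover have "differentiable_Rn d F" unfolding differentiable_Rn_def using hg by blast
  moreover have "bdd_below (F ` Rn d)" using m(1) by (intro bdd_belowI2)
  ultimately show "F \<in> PL_class L \<tau> \<Delta> d"
    unfolding PL_class_def using init PL lip
    by (auto simp: iv gr dist_Rn_eq norm_Rn_def L2_set_power2)
qed

section \<open>The Bernoulli oracle\<close>

text \<open>The Bernoulli variable is pushed to the reals, where the noise of an oracle lives; the
  value 1 marks an informative answer.\<close>

definition bern_noise :: "real \<Rightarrow> real measure" where
  "bern_noise p = measure_pmf (map_pmf of_bool (bernoulli_pmf p))"

definition bern_oracle ::
  "real \<Rightarrow> nat \<Rightarrow> (vect \<Rightarrow> vect) \<Rightarrow> (vect \<Rightarrow> vect) \<Rightarrow> grad_oracle" where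
  "bern_oracle p d q h = \<lparr>noise = bern_noise p,
     sample = (\<lambda>x \<xi>. \<lambda>n\<in>{..<d}. q x n + (if \<xi> = 1 then h x n / p else 0))\<rparr>"

lemma prob_space_bern_noise: "prob_space (bern_noise p)"
  unfolding bern_noise_def by (rule prob_space_measure_pmf)

lemma sets_bern_noise: "sets (bern_noise p) = UNIV"
  by (simp add: bern_noise_def)

lemma space_bern_noise[simp]: "space (bern_noise p) = UNIV"
  by (simp add: bern_noise_def)

lemma nn_integral_bern_noise:
  assumes "0 \<le> p" "p \<le> 1"
  shows "(\<integral>\<^sup>+\<xi>. f \<xi> \<partial>bern_noise p) = ennreal p * f 1 + ennreal (1 - p) * f 0"
  using assms by (simp add: bern_noise_def nn_integral_bernoulli_pmf mult.commute)

text \<open>The mean is \<open>q + p * (h / p)\<close>, the gradient. The error is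
  \<open>(1 / p - 1) * h\<close> with probability \<open>p\<close> and \<open>- h\<close> otherwise,
  so the variance is the squared norm of \<open>h\<close> times \<open>1 / p - 1\<close>.\<close>

lemma bern_oracle_in_BV_oracles:
  assumes p: "0 < p" "p \<le> 1"
    and [measurable]: "\<And>n. n < d \<Longrightarrow> (\<lambda>x. q x n) \<in> borel_measurable (borel_Rn d)"
      "\<And>n. n < d \<Longrightarrow> (\<lambda>x. h x n) \<in> borel_measurable (borel_Rn d)"
    and gr: "\<And>x. x \<in> Rn d \<Longrightarrow> grad d f x = restrict (\<lambda>n. q x n + h x n) {..<d}"
    and H: "\<And>x. (\<Sum>n<d. (h x n)\<^sup>2) \<le> B" and v: "B * (1 / p - 1) \<le> v"
  shows "bern_oracle p d q h \<in> BV_oracles v d f"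
proof -
  let ?G = "bern_oracle p d q h"
  have N: "noise ?G = bern_noise p" by (simp add: bern_oracle_def)
  have S: "sample ?G x \<xi> = (\<lambda>n\<in>{..<d}. q x n + (if \<xi> = 1 then h x n / p else 0))" for x \<xi>
    by (simp add: bern_oracle_def)
  have [measurable]: "Measurable.pred (bern_noise p) (\<lambda>\<xi>. \<xi> = 1)"
    by (simp add: pred_def sets_bern_noise)
  have m: "(\<lambda>(x, \<xi>). sample ?G x \<xi>) \<in> borel_Rn d \<Otimes>\<^sub>M bern_noise p \<rightarrow>\<^sub>M borel_Rn d"
    unfolding S split_beta' by (rule measurable_restrict) measurable
  have i: "integrable (bern_noise p) g" for g :: "real \<Rightarrow> real"
    unfolding bern_noise_def
    by (simp add: integrable_measure_pmf_finite)
  have e: "(\<integral>\<xi>. g \<xi> \<partial>bern_noise p) = p * g 1 + (1 - p) * g 0" for g :: "real \<Rightarrow> real"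
    using p by (simp add: bern_noise_def)
  have var: "(\<integral>\<^sup>+\<xi>. ennreal ((dist_Rn d (sample ?G x \<xi>) (grad d f x))\<^sup>2) \<partial>bern_noise p) \<le> ennreal v"
    if x: "x \<in> Rn d" for x
  proof -
    have D: "(dist_Rn d (sample ?G x \<xi>) (grad d f x))\<^sup>2 =
        (if \<xi> = 1 then (1/p - 1)\<^sup>2 else 1) * (\<Sum>n<d. (h x n)\<^sup>2)" for \<xi>
    proof -
      have "(dist_Rn d (sample ?G x \<xi>) (grad d f x))\<^sup>2 =
          (\<Sum>n<d. ((if \<xi> = 1 then 1/p - 1 else -1) * h x n)\<^sup>2)"
        unfolding dist_Rn_eq L2_set_power2 S gr[OF x]
        by (intro sum.cong) (auto simp: left_diff_distrib)
      then show ?thesis by (auto simp: power_mult_distrib sum_distrib_left)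
    qed
    have "(\<integral>\<^sup>+\<xi>. ennreal ((dist_Rn d (sample ?G x \<xi>) (grad d f x))\<^sup>2) \<partial>bern_noise p)
      = ennreal (p * ((1/p - 1)\<^sup>2 * (\<Sum>n<d. (h x n)\<^sup>2)) + (1 - p) * (\<Sum>n<d. (h x n)\<^sup>2))"
      using p unfolding D by (subst nn_integral_bern_noise) (auto simp: ennreal_mult[symmetric] ennreal_plus[symmetric] sum_nonneg simp del: ennreal_plus)
    also have "p * ((1/p - 1)\<^sup>2 * (\<Sum>n<d. (h x n)\<^sup>2)) + (1 - p) * (\<Sum>n<d. (h x n)\<^sup>2)
       = (\<Sum>n<d. (h x n)\<^sup>2) * (1 / p - 1)"
      using p by (simp add: field_simps power2_eq_square)
    also have "\<dots> \<le> B * (1 / p - 1)" using H p by (intro mult_right_mono) auto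
    also note v
    finally show ?thesis by (simp add: ennreal_leI)
  qed
  have "(\<integral>\<xi>. sample ?G x \<xi> n \<partial>bern_noise p) = grad d f x n" if "x \<in> Rn d" "n < d" for x n
    using that p unfolding e S gr[OF that(1)] by (simp add: field_simps)
  then show ?thesis
    unfolding BV_oracles_def mem_Collect_eq N using var i m prob_space_bern_noise by blast
qed

section \<open>Measurability of transcripts and iterates\<close>

lemma measurable_transcript:
  assumes A: "A \<in> sfo_methods" and d: "d \<ge> 1"
    and G: "(\<lambda>(x, \<xi>). sample G x \<xi>) \<in> borel_Rn d \<Otimes>\<^sub>M noise G \<rightarrow>\<^sub>M borel_Rn d"
    and "t \<le> T"
  shows "(\<lambda>(r, \<xi>). transcript A d G r \<xi> t)
    \<in> seed A d \<Otimes>\<^sub>M Pi\<^sub>M {..<T} (\<lambda>_. noise G) \<rightarrow>\<^sub>M Pi\<^sub>M {..<t} (\<lambda>_. borel_Rn d)"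
  using \<open>t \<le> T\<close>
proof (induction t)
  case 0
  have "(\<lambda>_. (\<lambda>_. undefined)) \<in> X \<rightarrow>\<^sub>M Pi\<^sub>M {..<0::nat} (\<lambda>_. borel_Rn d)" for X :: "'x measure"
    by (intro measurable_const) (simp add: space_PiM)
  then show ?case by (simp add: split_beta')
next
  case (Suc t)
  let ?M = "seed A d \<Otimes>\<^sub>M Pi\<^sub>M {..<T} (\<lambda>_. noise G)"
  have tr: "(\<lambda>w. transcript A d G (fst w) (snd w) t) \<in> ?M \<rightarrow>\<^sub>M Pi\<^sub>M {..<t} (\<lambda>_. borel_Rn d)"
    using Suc by (simp add: split_beta')
  have Q: "(\<lambda>(r, h). query A d t r h) \<in> seed A d \<Otimes>\<^sub>M Pi\<^sub>M {..<t} (\<lambda>_. borel_Rn d) \<rightarrow>\<^sub>M borel_Rn d"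
    using A d by (auto simp: sfo_methods_def)
  have q: "(\<lambda>w. query A d t (fst w) (transcript A d G (fst w) (snd w) t)) \<in> ?M \<rightarrow>\<^sub>M borel_Rn d"
    using measurable_compose[OF measurable_Pair[OF measurable_fst tr] Q] by simp
  have x: "(\<lambda>w. snd w t) \<in> ?M \<rightarrow>\<^sub>M noise G"
    using Suc by (intro measurable_compose[OF measurable_snd measurable_component_singleton]) auto
  have s: "(\<lambda>w. sample G (query A d t (fst w) (transcript A d G (fst w) (snd w) t)) (snd w t))
      \<in> ?M \<rightarrow>\<^sub>M borel_Rn d"
    using measurable_compose[OF measurable_Pair[OF q x] G] by simp
  show ?case
    unfolding transcript.simps split_beta'
    by (rule measurable_fun_upd[OF _ tr s]) auto
qed

lemma measurable_iterate:
  assumes A: "A \<in> sfo_methods" and d: "d \<ge> 1"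
    and G: "(\<lambda>(x, \<xi>). sample G x \<xi>) \<in> borel_Rn d \<Otimes>\<^sub>M noise G \<rightarrow>\<^sub>M borel_Rn d"
  shows "(\<lambda>w. iterate A d G T (fst w) (snd w))
    \<in> seed A d \<Otimes>\<^sub>M Pi\<^sub>M {..<T} (\<lambda>_. noise G) \<rightarrow>\<^sub>M borel_Rn d"
proof -
  let ?M = "seed A d \<Otimes>\<^sub>M Pi\<^sub>M {..<T} (\<lambda>_. noise G)"
  have tr: "(\<lambda>w. transcript A d G (fst w) (snd w) T) \<in> ?M \<rightarrow>\<^sub>M Pi\<^sub>M {..<T} (\<lambda>_. borel_Rn d)"
    using measurable_transcript[OF A d G, of T T] by (simp add: split_beta')
  have Q: "(\<lambda>(r, h). query A d T r h) \<in> seed A d \<Otimes>\<^sub>M Pi\<^sub>M {..<T} (\<lambda>_. borel_Rn d) \<rightarrow>\<^sub>M borel_Rn d"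
    using A d by (auto simp: sfo_methods_def)
  show ?thesis
    unfolding iterate_def
    using measurable_compose[OF measurable_Pair[OF measurable_fst tr] Q] by simp
qed

text \<open>Markov's inequality: the number of informative answers among \<open>T\<close> has mean
  \<open>T * p\<close>, which is at most half of \<open>m\<close>.\<close>

lemma prob_few_reveals:
  fixes S :: "real measure"
  assumes p: "0 \<le> p" "p \<le> 1" and m: "0 < m" "real T * p \<le> real m / 2" and S: "prob_space S"
  shows "ennreal (1/2) \<le> emeasure (S \<Otimes>\<^sub>M Pi\<^sub>M {..<T} (\<lambda>_. bern_noise p))
    {w \<in> space (S \<Otimes>\<^sub>M Pi\<^sub>M {..<T} (\<lambda>_. bern_noise p)). card {t. t < T \<and> snd w t = 1} < m}"
proof -
  let ?P = "Pi\<^sub>M {..<T} (\<lambda>_. bern_noise p)"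
  let ?M = "S \<Otimes>\<^sub>M ?P"
  interpret S: prob_space S by fact
  interpret P: prob_space ?P by (intro prob_space_PiM prob_space_bern_noise)
  interpret SP: pair_prob_space S ?P ..
  have [measurable]: "Measurable.pred ?M (\<lambda>w. snd w t = 1)" if "t \<in> {..<T}" for t
  proof -
    have "(\<lambda>w. snd w t) \<in> ?M \<rightarrow>\<^sub>M bern_noise p"
      using that by (intro measurable_compose[OF measurable_snd measurable_component_singleton]) auto
    moreover have "Measurable.pred (bern_noise p) (\<lambda>\<xi>. \<xi> = 1)"
      by (simp add: pred_def sets_bern_noise)
    ultimately show ?thesis by (rule measurable_compose)
  qed
  have card: "real (card {t. t < T \<and> snd w t = (1::real)}) = (\<Sum>t<T. indicator {w. snd w t = 1} w)"
    for w :: "real \<times> (nat \<Rightarrow> real)"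
  proof -
    have "(\<Sum>t<T. indicator {w. snd w t = 1} w) = (\<Sum>t<T. if snd w t = 1 then 1 else 0 :: real)"
      by (intro sum.cong) (auto simp: indicator_def)
    also have "\<dots> = (\<Sum>t\<in>{t\<in>{..<T}. snd w t = 1}. 1)" by (rule sum.inter_filter[symmetric]) simp
    also have "\<dots> = real (card {t. t < T \<and> snd w t = (1::real)})" by (simp add: lessThan_def)
    finally show ?thesis by simp
  qed
  let ?E = "{w \<in> space ?M. card {t. t < T \<and> snd w t = 1} < m}"
  let ?N = "\<lambda>w::real \<times> (nat \<Rightarrow> real). \<Sum>t<T. indicator {w \<in> space ?M. snd w t = 1} w :: ennreal"
  have sets_t: "{w \<in> space ?M. snd w t = 1} \<in> sets ?M" if "t \<in> {..<T}" for t
    using that by measurable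
  have "Measurable.pred ?M (\<lambda>w. (\<Sum>t<T. indicator {w. snd w t = 1} w) < real m)"
    by measurable
  then have E: "?E \<in> sets ?M"
    unfolding card[symmetric] of_nat_less_iff pred_def .
  have et: "emeasure ?M {w \<in> space ?M. snd w t = 1} = ennreal p" if t: "t \<in> {..<T}" for t
  proof -
    have eq: "{w \<in> space ?M. snd w t = 1} = space S \<times> {\<xi> \<in> space ?P. \<xi> t = 1}"
      by (auto simp: space_pair_measure)
    have ms: "{\<xi> \<in> space ?P. \<xi> t = 1} = (\<lambda>\<xi>. \<xi> t) -` {1} \<inter> space ?P" by auto
    have meas: "(\<lambda>\<xi>. \<xi> t) \<in> ?P \<rightarrow>\<^sub>M bern_noise p" using t by measurable
    have st: "{\<xi> \<in> space ?P. \<xi> t = 1} \<in> sets ?P"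
      unfolding ms using meas by (rule measurable_sets) (simp add: sets_bern_noise)
    have "emeasure ?P {\<xi> \<in> space ?P. \<xi> t = 1} = emeasure (distr ?P (bern_noise p) (\<lambda>\<xi>. \<xi> t)) {1}"
      unfolding ms using meas by (subst emeasure_distr) (simp_all add: sets_bern_noise)
    also have "distr ?P (bern_noise p) (\<lambda>\<xi>. \<xi> t) = bern_noise p"
      using t by (intro distr_PiM_component prob_space_bern_noise) auto
    also have "emeasure (bern_noise p) {1} = (\<integral>\<^sup>+\<xi>. indicator {1} \<xi> \<partial>bern_noise p)"
      by (simp add: sets_bern_noise)
    also have "\<dots> = ennreal p" by (simp add: nn_integral_bern_noise p)
    finally show ?thesis
      unfolding eq using st by (subst P.emeasure_pair_measure_Times) (auto simp: S.emeasure_space_1)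
  qed
  have "1 = (\<integral>\<^sup>+w. 1 \<partial>?M)" by (simp add: SP.emeasure_space_1)
  \<comment> \<open>The pointwise form of Markov's inequality: off \<open>?E\<close> the count
    divided by \<open>m\<close> is at least 1.\<close>
  also have "\<dots> \<le> (\<integral>\<^sup>+w. indicator ?E w + ennreal (1 / real m) * ?N w \<partial>?M)"
  proof (rule nn_integral_mono)
    fix w assume w: "w \<in> space ?M"
    have N: "?N w = ennreal (real (card {t. t < T \<and> snd w t = 1}))"
    proof -
      have "?N w = (\<Sum>t<T. ennreal (indicator {w. snd w t = 1} w))"
        using w by (intro sum.cong) (auto simp: indicator_def)
      then show ?thesis unfolding card by (simp add: sum_ennreal)
    qed
    show "1 \<le> indicator ?E w + ennreal (1 / real m) * ?N w"
    proof (cases "w \<in> ?E")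
      case False
      with w have "m \<le> card {t. t < T \<and> snd w t = 1}" by auto
      then have "1 \<le> 1 / real m * real (card {t. t < T \<and> snd w t = 1})"
        using m by (simp add: field_simps)
      then have "ennreal 1 \<le> ennreal (1 / real m * real (card {t. t < T \<and> snd w t = 1}))"
        by (rule ennreal_leI)
      then show ?thesis using False unfolding N by (subst (asm) ennreal_mult) auto
    qed (auto simp: N)
  qed
  also have "\<dots> = emeasure ?M ?E + ennreal (1 / real m) * (\<Sum>t<T. ennreal p)"
    using E sets_t et
    by (subst nn_integral_add) (auto simp: nn_integral_cmult nn_integral_sum intro!: borel_measurable_sum)
  also have "(\<Sum>t<T. ennreal p) = ennreal (real T * p)"
    using p by (simp add: ennreal_of_nat_eq_real_of_nat ennreal_mult)
  also have "ennreal (1 / real m) * ennreal (real T * p) = ennreal (real T * p / real m)"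
    using p by (subst ennreal_mult[symmetric]) auto
  also have "\<dots> \<le> ennreal (1/2)" using m by (intro ennreal_leI) (simp add: field_simps)
  finally have "ennreal 1 \<le> emeasure ?M ?E + ennreal (1/2)" by (simp add: add_left_mono)
  then have "ennreal 1 \<le> ennreal (measure ?M ?E + 1/2)"
    by (simp add: SP.emeasure_eq_measure)
  then have "1/2 \<le> measure ?M ?E" by (subst (asm) ennreal_le_iff) auto
  then show ?thesis unfolding SP.emeasure_eq_measure by (rule ennreal_leI)
qed

text \<open>A supremum is at least the average over the finite family \<open>I\<close>. All members
  share one noise measure, so sum and integral can be exchanged, and the hypothesis on the gap
  concerns a fixed seed and a fixed noise sequence. The factor 1/2 comes from
  \<open>prob_few_reveals\<close>.\<close>

lemma minimax_gap_ge:
  assumes I: "finite I" "I \<noteq> {}" and d: "d \<ge> 1"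
    and f: "\<And>i. i \<in> I \<Longrightarrow> f i \<in> PL_class L \<tau> \<Delta> d"
    and fm: "\<And>i. i \<in> I \<Longrightarrow> f i \<in> borel_measurable (borel_Rn d)"
    and gr: "\<And>i x. i \<in> I \<Longrightarrow> x \<in> Rn d \<Longrightarrow> grad d (f i) x = restrict (\<lambda>n. q i x n + h i x n) {..<d}"
    and qm: "\<And>i n. i \<in> I \<Longrightarrow> n < d \<Longrightarrow> (\<lambda>x. q i x n) \<in> borel_measurable (borel_Rn d)"
    and hm: "\<And>i n. i \<in> I \<Longrightarrow> n < d \<Longrightarrow> (\<lambda>x. h i x n) \<in> borel_measurable (borel_Rn d)"
    and B: "\<And>i x. i \<in> I \<Longrightarrow> (\<Sum>n<d. (h i x n)\<^sup>2) \<le> B" and v: "B * (1 / p - 1) \<le> v"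
    and p: "0 < p" "p \<le> 1" and m: "0 < m" "real T * p \<le> real m / 2" and c: "0 \<le> c"
    and inf: "\<And>i x. i \<in> I \<Longrightarrow> inf_val d (f i) \<le> f i x"
    and gap: "\<And>A r \<xi>. card {t. t < T \<and> \<xi> t = 1} < m \<Longrightarrow>
      c * real (card I) \<le>
        (\<Sum>i\<in>I. f i (iterate A d (bern_oracle p d (q i) (h i)) T r \<xi>) - inf_val d (f i))"
  shows "ennreal (c / 2) \<le> minimax_gap L \<tau> \<Delta> v T"
  unfolding minimax_gap_def
proof (rule INF_greatest)
  fix A assume A: "A \<in> sfo_methods"
  define G where "G i = bern_oracle p d (q i) (h i)" for i
  have G: "G i \<in> BV_oracles v d (f i)" if "i \<in> I" for i
    unfolding G_def using that p gr qm hm B v by (intro bern_oracle_in_BV_oracles) auto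
  have N: "noise (G i) = bern_noise p" for i by (simp add: G_def bern_oracle_def)
  define M where "M = seed A d \<Otimes>\<^sub>M Pi\<^sub>M {..<T} (\<lambda>_. bern_noise p)"
  define E where "E = {w \<in> space M. card {t. t < T \<and> snd w t = 1} < m}"
  define D where "D i w = f i (iterate A d (G i) T (fst w) (snd w)) - inf_val d (f i)" for i w
  let ?S = "SUP d\<in>{1..}. SUP f\<in>PL_class L \<tau> \<Delta> d. SUP G\<in>BV_oracles v d f. expected_gap A d f G T"
  have S: "prob_space (seed A d)" using A d by (auto simp: sfo_methods_def)
  have Dm: "D i \<in> borel_measurable M" if i: "i \<in> I" for i
  proof -
    have "(\<lambda>(x, \<xi>). sample (G i) x \<xi>) \<in> borel_Rn d \<Otimes>\<^sub>M noise (G i) \<rightarrow>\<^sub>M borel_Rn d"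
      using G[OF i] by (simp add: BV_oracles_def)
    from measurable_iterate[OF A d this, of T]
    have "(\<lambda>w. f i (iterate A d (G i) T (fst w) (snd w))) \<in> borel_measurable M"
      unfolding N M_def by (rule measurable_compose[OF _ fm[OF i]])
    then show ?thesis unfolding D_def by measurable
  qed
  have D0: "D i w \<ge> 0" if "i \<in> I" for i w using inf[OF that] by (simp add: D_def)
  have eg: "expected_gap A d (f i) (G i) T = (\<integral>\<^sup>+w. ennreal (D i w) \<partial>M)" for i
    by (simp add: expected_gap_def N M_def D_def split_beta')
  have PE: "ennreal (1/2) \<le> emeasure M E"
    unfolding M_def E_def using p by (intro prob_few_reveals S m) auto
  \<comment> \<open>A non-measurable set has \<open>emeasure\<close> 0, which \<open>PE\<close>
    excludes.\<close>
  have Em: "E \<in> sets M"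
  proof (rule ccontr)
    assume "E \<notin> sets M"
    then have "emeasure M E = 0" by (rule emeasure_notin_sets)
    with PE show False by simp
  qed
  have "ennreal (real (card I) * (c / 2)) = ennreal (c * real (card I)) * ennreal (1/2)"
    using c by (subst ennreal_mult[symmetric]) (auto simp: mult.commute)
  also have "\<dots> \<le> ennreal (c * real (card I)) * emeasure M E" by (intro mult_left_mono PE) auto
  also have "\<dots> = (\<integral>\<^sup>+w. ennreal (c * real (card I)) * indicator E w \<partial>M)"
    using Em by (simp add: nn_integral_cmult_indicator)
  also have "\<dots> \<le> (\<integral>\<^sup>+w. (\<Sum>i\<in>I. ennreal (D i w)) \<partial>M)"
  proof (rule nn_integral_mono)
    fix w
    show "ennreal (c * real (card I)) * indicator E w \<le> (\<Sum>i\<in>I. ennreal (D i w))"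
    proof (cases "w \<in> E")
      case True
      then have "c * real (card I) \<le> (\<Sum>i\<in>I. D i w)"
        unfolding D_def G_def by (intro gap) (simp add: E_def)
      then show ?thesis using True D0 by (simp add: sum_ennreal ennreal_leI)
    qed auto
  qed
  also have "\<dots> = (\<Sum>i\<in>I. expected_gap A d (f i) (G i) T)"
    unfolding eg using Dm by (intro nn_integral_sum) auto
  also have "\<dots> \<le> (\<Sum>i\<in>I. ?S)"
  proof (rule sum_mono)
    fix i assume i: "i \<in> I"
    show "expected_gap A d (f i) (G i) T \<le> ?S"
      using d by (intro SUP_upper2[of d] SUP_upper2[OF f[OF i]] SUP_upper2[OF G[OF i]]) auto
  qed
  also have "\<dots> = ennreal (real (card I)) * ?S"
    by (simp add: ennreal_of_nat_eq_real_of_nat)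
  finally have "ennreal (real (card I)) * ennreal (c / 2) \<le> ennreal (real (card I)) * ?S"
    using c by (simp add: ennreal_mult[symmetric])
  moreover have "0 < real (card I)" using I by (simp add: card_gt_0_iff)
  ultimately show "ennreal (c / 2) \<le> ?S"
    by (subst (asm) ennreal_mult_le_mult_iff) auto
qed

section \<open>Gate and head potential\<close>

text \<open>The hat function supported on [0, 2] with peak 1 at 1.\<close>

definition tent :: "real \<Rightarrow> real" where
  "tent u = max 0 u - 2 * max 0 (u - 1) + max 0 (u - 2)"

text \<open>A continuously differentiable step that falls from 1 at 1/4 to 0 at 1/2, obtained by
  integrating \<open>tent\<close>. Squares of positive parts make it differentiable by one rule,
  without a case distinction.\<close>

definition gate :: "real \<Rightarrow> real" where
  "gate s = 1 - ((max 0 (8 * s-2))\<^sup>2 - 2 * (max 0 (8 * s-3))\<^sup>2 + (max 0 (8 * s-4))\<^sup>2) / 2"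

lemma tent_bounds: "0 \<le> tent u" "tent u \<le> 1"
  by (auto simp: tent_def max_def)

lemma tent_zero: "u \<le> 0 \<or> 2 \<le> u \<Longrightarrow> tent u = 0"
  by (auto simp: tent_def max_def)

lemma tent_lipschitz: "\<bar>tent u - tent v\<bar> \<le> \<bar>u - v\<bar>"
  unfolding tent_def max_def by (auto split: if_splits simp: abs_if)

lemma DERIV_max0_power2: "((\<lambda>u::real. (max 0 u)\<^sup>2) has_real_derivative 2 * max 0 u) (at u)"
proof (cases u "0::real" rule: linorder_cases)
  case less
  have "((\<lambda>u::real. 0) has_real_derivative 2 * max 0 u) (at u)" using less by simp
  then show ?thesis
    by (rule has_field_derivative_transform_within_open[of _ _ _ "{..<0}"]) (use less in auto)
next
  case greater
  have "((\<lambda>u::real. u\<^sup>2) has_real_derivative 2 * max 0 u) (at u)"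
    using greater by (auto intro!: derivative_eq_intros)
  then show ?thesis
    by (rule has_field_derivative_transform_within_open[of _ _ _ "{0<..}"]) (use greater in auto)
next
  case equal
  have "((\<lambda>h. (max 0 h)\<^sup>2 / h) \<longlongrightarrow> 0) (at (0::real))"
  proof (rule tendsto_rabs_zero_cancel, rule tendsto_sandwich[of "\<lambda>_. 0" _ _ "\<lambda>h. \<bar>h\<bar>"])
    show "\<forall>\<^sub>F h in at (0::real). \<bar>(max 0 h)\<^sup>2 / h\<bar> \<le> \<bar>h\<bar>"
      by (intro always_eventually) (auto simp: max_def power2_eq_square)
    show "((\<lambda>h. \<bar>h\<bar>) \<longlongrightarrow> 0) (at (0::real))" by (auto intro!: tendsto_eq_intros)
  qed auto
  then show ?thesis using equal by (simp add: DERIV_def)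
qed

lemma DERIV_gate: "(gate has_real_derivative - 8 * tent (8 * s-2)) (at s)"
proof -
  have D: "((\<lambda>s. (max 0 (8 * s-c))\<^sup>2) has_real_derivative 8 * (2 * max 0 (8 * s-c))) (at s)" for c
    by (rule DERIV_chain'[OF _ DERIV_max0_power2, of _ 8, THEN DERIV_cong])
       (auto intro!: derivative_eq_intros)
  have "(gate has_real_derivative 0 - (8 * (2 * max 0 (8 * s - 2)) - 2 * (8 * (2 * max 0 (8 * s - 3)))
      + 8 * (2 * max 0 (8 * s - 4))) / 2) (at s)"
    unfolding gate_def[abs_def]
    by (intro DERIV_diff DERIV_const DERIV_cdivide DERIV_add DERIV_cmult D)
  then show ?thesis by (rule DERIV_cong) (simp add: tent_def field_simps)
qed

lemma gate_one: "s \<le> 1/4 \<Longrightarrow> gate s = 1"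
  by (simp add: gate_def max_def)

lemma gate_zero: "1/2 \<le> s \<Longrightarrow> gate s = 0"
  by (simp add: gate_def max_def power2_eq_square algebra_simps)

lemma gate_antimono: "s \<le> t \<Longrightarrow> gate t \<le> gate s"
  by (rule DERIV_nonpos_imp_nonincreasing[of s t gate]) (use DERIV_gate tent_bounds in force)+

lemma gate_bounds: "0 \<le> gate s" "gate s \<le> 1"
proof -
  show "0 \<le> gate s" using gate_antimono[of s "max s (1/2)"] gate_zero[of "max s (1/2)"] by simp
  show "gate s \<le> 1" using gate_antimono[of "min s (1/4)" s] gate_one[of "min s (1/4)"] by simp
qed

text \<open>The gate will be applied to a squared norm, which is not globally Lipschitz. Clamped at
  1 it is, and since the gate is constant from 1/2 on, clamping changes nothing.\<close>

lemma gate_clamp: "gate (min s 1) = gate s"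
  using gate_zero by (cases "s \<le> 1") auto

lemma tent_clamp: "tent (8 * min s 1 - 2) = tent (8 * s-2)"
  using tent_zero by (cases "s \<le> 1") auto

lemma gate_lipschitz: "\<bar>gate s - gate t\<bar> \<le> 8 * \<bar>min s 1 - min t 1\<bar>"
proof -
  have *: "\<bar>gate a - gate b\<bar> \<le> 8 * (b - a)" if ab: "a < b" for a b
  proof -
    obtain z where "gate b - gate a = (b - a) * (- 8 * tent (8*z-2))"
      using MVT2[OF ab, of gate "\<lambda>s. - 8 * tent (8 * s-2)"] DERIV_gate by auto
    then have "\<bar>gate a - gate b\<bar> = (b - a) * (8 * tent (8*z-2))"
      using ab tent_bounds[of "8*z-2"] by (simp add: abs_mult abs_minus_commute[of "gate a"])
    also have "\<dots> \<le> (b - a) * (8 * 1)"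
      using ab tent_bounds[of "8*z-2"] by (intro mult_left_mono) auto
    finally show ?thesis by simp
  qed
  have "\<bar>gate a - gate b\<bar> \<le> 8 * \<bar>a - b\<bar>" for a b
    using *[of a b] *[of b a] by (cases a b rule: linorder_cases) auto
  from this[of "min s 1" "min t 1"] show ?thesis by (simp add: gate_clamp)
qed

lemma min_power2_lipschitz:
  fixes a b :: real
  assumes "0 \<le> a" "0 \<le> b"
  shows "\<bar>min (a\<^sup>2) 1 - min (b\<^sup>2) 1\<bar> \<le> 2 * \<bar>a - b\<bar>"
proof -
  have m: "min (c\<^sup>2) 1 = (min c 1)\<^sup>2" if "0 \<le> c" for c :: real
    using that by (cases "c \<le> 1") (auto simp: min_def power_le_one_iff abs_square_le_1 dest: power2_le_imp_le)
  have "\<bar>(min a 1)\<^sup>2 - (min b 1)\<^sup>2\<bar> = \<bar>min a 1 + min b 1\<bar> * \<bar>min a 1 - min b 1\<bar>"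
    by (simp add: power2_eq_square abs_mult[symmetric] algebra_simps)
  also have "\<dots> \<le> 2 * \<bar>a - b\<bar>" using assms by (intro mult_mono) auto
  finally show ?thesis using assms by (simp add: m)
qed

lemma L2_set_minus_commute: "L2_set (\<lambda>l. f l - g l) A = L2_set (\<lambda>l. g l - f l) A"
  by (simp add: L2_set_def power2_commute)

lemma L2_set_diff_le: "\<bar>L2_set f A - L2_set g A\<bar> \<le> L2_set (\<lambda>l. f l - g l) A"
  using L2_set_triangle_ineq[of "\<lambda>l. f l - g l" g A] L2_set_triangle_ineq[of "\<lambda>l. g l - f l" f A]
  by (simp add: L2_set_minus_commute[of g f])

lemma min_sum_squares_lipschitz:
  fixes f g :: "'a \<Rightarrow> real"
  shows "\<bar>min (\<Sum>l\<in>A. (f l)\<^sup>2) 1 - min (\<Sum>l\<in>A. (g l)\<^sup>2) 1\<bar> \<le> 2 * L2_set (\<lambda>l. f l - g l) A"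
  using min_power2_lipschitz[of "L2_set f A" "L2_set g A"] L2_set_diff_le[of f A g]
  by (simp add: L2_set_power2)

lemma gate_sum_squares_lipschitz:
  "\<bar>gate (\<Sum>l\<in>A. (f l)\<^sup>2) - gate (\<Sum>l\<in>A. (g l)\<^sup>2)\<bar> \<le> 16 * L2_set (\<lambda>l. f l - g l) A"
proof -
  have "\<bar>gate (\<Sum>l\<in>A. (f l)\<^sup>2) - gate (\<Sum>l\<in>A. (g l)\<^sup>2)\<bar>
      \<le> 8 * \<bar>min (\<Sum>l\<in>A. (f l)\<^sup>2) 1 - min (\<Sum>l\<in>A. (g l)\<^sup>2) 1\<bar>"
    by (rule gate_lipschitz)
  also have "\<dots> \<le> 8 * (2 * L2_set (\<lambda>l. f l - g l) A)"
    by (intro mult_left_mono min_sum_squares_lipschitz) simp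
  finally show ?thesis by simp
qed

text \<open>Up to the factor -16 this is the gradient of \<open>gate\<close> applied to the squared
  norm of \<open>f\<close>. It vanishes off the shell of squared radii between 1/4 and 1/2.\<close>

definition radial :: "'a set \<Rightarrow> ('a \<Rightarrow> real) \<Rightarrow> 'a \<Rightarrow> real" where
  "radial A f l = tent (8 * (\<Sum>l\<in>A. (f l)\<^sup>2) - 2) * f l"

lemma radial_zero: "1/2 \<le> (\<Sum>l\<in>A. (f l)\<^sup>2) \<or> (\<Sum>l\<in>A. (f l)\<^sup>2) \<le> 1/4 \<Longrightarrow> radial A f l = 0"
  by (auto simp: radial_def tent_zero)

lemma L2_set_radial: "L2_set (radial A f) A \<le> 1"
proof (cases "1/2 \<le> (\<Sum>l\<in>A. (f l)\<^sup>2)")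
  case True
  then show ?thesis by (simp add: radial_zero L2_set_def)
next
  case False
  have "L2_set (radial A f) A = \<bar>tent (8 * (\<Sum>l\<in>A. (f l)\<^sup>2) - 2)\<bar> * L2_set f A"
    unfolding radial_def by (rule L2_set_scale)
  also have "\<dots> \<le> 1 * 1" using False tent_bounds
    by (intro mult_mono) (auto simp: L2_set_def sum_nonneg)
  finally show ?thesis by simp
qed

text \<open>Product rule: with \<open>t\<close>, \<open>u\<close> the values of \<open>tent\<close>,
  the difference is \<open>t * (f - g) + (t - u) * g\<close>. The second summand needs
  \<open>g\<close> of norm at most 1; by symmetry \<open>f\<close> may serve instead, and if both
  are longer, both sides are covered by \<open>radial_zero\<close>. The constant is 1 + 16.\<close>

lemma radial_lipschitz:
  "L2_set (\<lambda>l. radial A f l - radial A g l) A \<le> 17 * L2_set (\<lambda>l. f l - g l) A"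
proof -
  have *: "L2_set (\<lambda>l. radial A f l - radial A g l) A \<le> 17 * L2_set (\<lambda>l. f l - g l) A"
    if g: "(\<Sum>l\<in>A. (g l)\<^sup>2) \<le> 1" for f g
  proof -
    let ?t = "tent (8 * (\<Sum>l\<in>A. (f l)\<^sup>2) - 2)" and ?u = "tent (8 * (\<Sum>l\<in>A. (g l)\<^sup>2) - 2)"
    let ?D = "L2_set (\<lambda>l. f l - g l) A"
    have tu: "\<bar>?t - ?u\<bar> \<le> 16 * ?D"
      using tent_lipschitz[of "8 * min (\<Sum>l\<in>A. (f l)\<^sup>2) 1 - 2" "8 * min (\<Sum>l\<in>A. (g l)\<^sup>2) 1 - 2"]
        min_sum_squares_lipschitz[of f A g]
      by (simp add: tent_clamp)
    have "L2_set (\<lambda>l. radial A f l - radial A g l) A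
        = L2_set (\<lambda>l. ?t * (f l - g l) + (?t - ?u) * g l) A"
      unfolding radial_def by (simp add: algebra_simps)
    also have "\<dots> \<le> \<bar>?t\<bar> * ?D + \<bar>?t - ?u\<bar> * L2_set g A"
      using L2_set_triangle_ineq[of "\<lambda>l. ?t * (f l - g l)" "\<lambda>l. (?t - ?u) * g l" A]
      by (simp add: L2_set_scale)
    also have "\<dots> \<le> 1 * ?D + (16 * ?D) * 1"
      using tu g tent_bounds by (intro add_mono mult_mono) (auto simp: L2_set_def sum_nonneg)
    finally show ?thesis by simp
  qed
  consider "(\<Sum>l\<in>A. (g l)\<^sup>2) \<le> 1" | "(\<Sum>l\<in>A. (f l)\<^sup>2) \<le> 1"
    | "1 < (\<Sum>l\<in>A. (g l)\<^sup>2)" "1 < (\<Sum>l\<in>A. (f l)\<^sup>2)" by linarith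
  then show ?thesis
  proof cases
    case 2
    from *[OF this, of g] show ?thesis
      by (simp add: L2_set_minus_commute[of g f] L2_set_minus_commute[of "radial A g"])
  next
    case 1
    then show ?thesis by (rule *)
  next
    case 3
    then show ?thesis by (simp add: radial_zero) (simp add: L2_set_def sum_nonneg)
  qed
qed

text \<open>The shift by \<open>pi\<close> makes it nonnegative, and the factor 2 gives
  \<open>rho' 1 = 1\<close>, which makes 1 a stationary point of
  \<open>y\<^sup>2 / 2 - rho y\<close>. At 0 the slope of this potential is -2, so the origin is not
  stationary.\<close>

definition rho :: "real \<Rightarrow> real" where "rho y = 2 * arctan y + pi"

definition rho' :: "real \<Rightarrow> real" where "rho' y = 2 / (1 + y\<^sup>2)"

lemma DERIV_rho: "(rho has_real_derivative rho' y) (at y)"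
  unfolding rho_def[abs_def] rho'_def by (auto intro!: derivative_eq_intros simp: field_simps)

lemma rho_bounds: "0 \<le> rho y" "rho y \<le> 7"
  using arctan_bounded[of y] pi_less_4 pi_approx by (auto simp: rho_def)

lemma rho'_bounds: "0 \<le> rho' y" "rho' y \<le> 2"
  by (auto simp: rho'_def field_simps add_pos_nonneg)

lemma DERIV_abs_bound_imp_lipschitz:
  fixes f :: "real \<Rightarrow> real"
  assumes "\<And>z. (f has_real_derivative f' z) (at z)" "\<And>z. \<bar>f' z\<bar> \<le> C"
  shows "\<bar>f x - f y\<bar> \<le> C * \<bar>x - y\<bar>"
proof -
  have "norm (f x - f y) \<le> C * norm (x - y)"
    by (rule field_differentiable_bound[of UNIV f f']) (use assms in auto)
  then show ?thesis by simp
qed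

lemma rho_lipschitz: "\<bar>rho x - rho y\<bar> \<le> 2 * \<bar>x - y\<bar>"
  by (rule DERIV_abs_bound_imp_lipschitz[OF DERIV_rho]) (use rho'_bounds in auto)

lemma rho'_lipschitz: "\<bar>rho' x - rho' y\<bar> \<le> 2 * \<bar>x - y\<bar>"
proof (rule DERIV_abs_bound_imp_lipschitz)
  fix z :: real
  have n: "1 + z\<^sup>2 > 0" by (simp add: add_pos_nonneg)
  show "(rho' has_real_derivative (- 4 * z / (1 + z\<^sup>2)\<^sup>2)) (at z)"
    unfolding rho'_def[abs_def] using n
    by (auto intro!: derivative_eq_intros simp: power2_eq_square field_simps)
  have "0 \<le> (\<bar>z\<bar> - 1)\<^sup>2" by simp
  then have "2 * \<bar>z\<bar> \<le> 1 + z\<^sup>2" by (simp add: power2_diff)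
  then have "4 * \<bar>z\<bar> \<le> 2 * (1 + z\<^sup>2) * 1" by simp
  also have "\<dots> \<le> 2 * (1 + z\<^sup>2) * (1 + z\<^sup>2)" by (intro mult_left_mono) auto
  finally have "4 * \<bar>z\<bar> \<le> 2 * (1 + z\<^sup>2)\<^sup>2" by (simp only: power2_eq_square mult.assoc)
  then show "\<bar>- 4 * z / (1 + z\<^sup>2)\<^sup>2\<bar> \<le> 2"
    using n by (simp add: abs_mult divide_le_eq)
qed

text \<open>\<open>y - rho' y\<close> is the slope of the potential \<open>y\<^sup>2 / 2 - rho y\<close> of the hidden coordinate
  of an active block, so the next two lemmas locate its minimum at \<open>y = 1\<close>.\<close>

lemma head_slope: "(y - 1)\<^sup>2 / 2 \<le> (y - rho' y) * (y - 1)"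
proof -
  have n: "1 + y\<^sup>2 > 0" by (simp add: add_pos_nonneg)
  \<comment> \<open>This uses
    \<open>y - rho' y = (y - 1) * (y\<^sup>2 + y + 2) / (1 + y\<^sup>2)\<close>; what is left of the
    quadratic factor is a sum of squares.\<close>
  have "(y - rho' y) * (y - 1) - (y - 1)\<^sup>2 / 2 = (y - 1)\<^sup>2 * ((y + 1)\<^sup>2 + 2) / (2 * (1 + y\<^sup>2))"
    using n by (simp add: rho'_def field_simps power2_eq_square)
  also have "\<dots> \<ge> 0" using n by simp
  finally show ?thesis by simp
qed

lemma head_slope_le: "(y - rho' y) * (y - 1) \<le> 3 * (y - 1)\<^sup>2"
proof -
  have n: "1 + y\<^sup>2 > 0" by (simp add: add_pos_nonneg)
  have "3 * (y - 1)\<^sup>2 - (y - rho' y) * (y - 1) =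
      (y - 1)\<^sup>2 * (y\<^sup>2 + (y - 1/2)\<^sup>2 + 3/4) / (1 + y\<^sup>2)"
    using n by (simp add: rho'_def field_simps power2_eq_square)
  also have "\<dots> \<ge> 0" using n by simp
  finally show ?thesis by simp
qed

section \<open>The chain function\<close>

text \<open>A function whose derivative at \<open>z\<close> has the sign of \<open>z - 1\<close> is
  minimal at 1. This is applied to the head potential and to \<open>3/2 * (y - 1)\<^sup>2\<close>
  minus that potential; the signs are \<open>head_slope\<close> and
  \<open>head_slope_le\<close>.\<close>

lemma head_min: "1/2 - rho 1 \<le> y\<^sup>2 / 2 - rho y"
  and head_max: "y\<^sup>2 / 2 - rho y \<le> 1/2 - rho 1 + 3/2 * (y - 1)\<^sup>2"
proof -
  have *: "f 1 \<le> f y" if D: "\<And>z. (f has_real_derivative f' z) (at z)"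
    and s: "\<And>z. 0 \<le> f' z * (z - 1)" for f f' :: "real \<Rightarrow> real"
  proof (cases y "1::real" rule: linorder_cases)
    case less
    then obtain z where "z < 1" "f 1 - f y = (1 - y) * f' z" using MVT2[OF less, of f f'] D by auto
    moreover from this s[of z] have "f' z \<le> 0" by (auto simp: zero_le_mult_iff)
    ultimately show ?thesis using less mult_nonneg_nonpos[of "1 - y" "f' z"] by simp
  next
    case greater
    then obtain z where "1 < z" "f y - f 1 = (y - 1) * f' z" using MVT2[OF greater, of f f'] D by auto
    moreover from this s[of z] have "0 \<le> f' z" by (auto simp: zero_le_mult_iff)
    moreover from this greater have "0 \<le> (y - 1) * f' z" by simp
    ultimately show ?thesis by linarith
  qed simp
  have D: "((\<lambda>y. y\<^sup>2 / 2 - rho y) has_real_derivative z - rho' z) (at z)" for z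
    by (auto intro!: derivative_eq_intros DERIV_rho)
  have "0 \<le> (z - rho' z) * (z - 1)" for z
    by (rule order_trans[OF _ head_slope]) simp
  from *[OF D this] show "1/2 - rho 1 \<le> y\<^sup>2 / 2 - rho y" by simp
  have D2: "((\<lambda>y. 3/2 * (y - 1)\<^sup>2 - (y\<^sup>2 / 2 - rho y)) has_real_derivative 3 * (z - 1) - (z - rho' z)) (at z)" for z
    by (auto intro!: derivative_eq_intros DERIV_rho)
  have "0 \<le> (3 * (z - 1) - (z - rho' z)) * (z - 1)" for z
    using head_slope_le[of z] by (simp add: power2_eq_square algebra_simps)
  from *[OF D2 this] show "y\<^sup>2 / 2 - rho y \<le> 1/2 - rho 1 + 3/2 * (y - 1)\<^sup>2" by simp
qed

lemma rho_1: "9/2 \<le> rho 1" "rho 1 \<le> 11/2"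
  using pi_approx by (auto simp: rho_def arctan_one)

lemma sum_blocks:
  fixes \<phi> :: "nat \<Rightarrow> real"
  shows "(\<Sum>n<K * M. \<phi> n) = (\<Sum>k<K. \<Sum>l<M. \<phi> (k * M + l))"
proof -
  have "(\<Sum>n\<in>{k * M..<k * M + M}. \<phi> n) = (\<Sum>l<M. \<phi> (k * M + l))" for k
    by (rule sum.reindex_bij_witness[of _ "\<lambda>l. k * M + l" "\<lambda>n. n - k * M"]) auto
  then show ?thesis by (simp add: sum.nat_group[symmetric])
qed

lemma sum_one_block:
  fixes \<phi> :: "nat \<Rightarrow> real"
  assumes "j < K"
  shows "(\<Sum>n<K * M. if n div M = j then \<phi> n else 0) = (\<Sum>l<M. \<phi> (j * M + l))"
proof -
  have "(\<Sum>n<K * M. if n div M = j then \<phi> n else 0)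
      = (\<Sum>k<K. if k = j then (\<Sum>l<M. \<phi> (k * M + l)) else 0)"
    unfolding sum_blocks by (intro sum.cong) auto
  then show ?thesis using assms by simp
qed

text \<open>A point of \<open>\<real>\<^sup>d\<close> with \<open>d = K * M\<close> consists of \<open>K\<close> blocks of length \<open>M\<close>. Block
  \<open>k\<close> has squared distance \<open>dev\<close> to its hidden target \<open>e\<^bsub>\<iota> k\<^esub>\<close>; its potential is switched on
  by \<open>pre\<close>, which is 1 if block \<open>k - 1\<close> is within \<open>1/4\<close> and 0 if it is not within \<open>1/2\<close>. The balls
  of squared radius \<open>1/2\<close> around distinct unit vectors are disjoint.\<close>

definition dv :: "nat \<Rightarrow> (nat \<Rightarrow> nat) \<Rightarrow> nat \<Rightarrow> vect \<Rightarrow> nat \<Rightarrow> real" where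
  "dv M \<iota> k x l = x (k * M + l) - of_bool (l = \<iota> k)"

definition dev :: "nat \<Rightarrow> (nat \<Rightarrow> nat) \<Rightarrow> nat \<Rightarrow> vect \<Rightarrow> real" where
  "dev M \<iota> k x = (\<Sum>l<M. (dv M \<iota> k x l)\<^sup>2)"

primrec pre :: "nat \<Rightarrow> (nat \<Rightarrow> nat) \<Rightarrow> nat \<Rightarrow> vect \<Rightarrow> real" where
  "pre M \<iota> 0 x = 1"
| "pre M \<iota> (Suc k) x = gate (dev M \<iota> k x)"

text \<open>The gradient of \<open>pre\<close>, supported on the coordinates of the preceding block.
  The factor 16 is the 8 in the slope of \<open>gate\<close> times the 2 from the squared
  distance.\<close>

primrec dpre :: "nat \<Rightarrow> (nat \<Rightarrow> nat) \<Rightarrow> nat \<Rightarrow> vect \<Rightarrow> vect" where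
  "dpre M \<iota> 0 x = (\<lambda>n. 0)"
| "dpre M \<iota> (Suc k) x =
     (\<lambda>n. if n div M = k then - 16 * radial {..<M} (dv M \<iota> k x) (n mod M) else 0)"

definition dterm :: "nat \<Rightarrow> (nat \<Rightarrow> nat) \<Rightarrow> nat \<Rightarrow> vect \<Rightarrow> vect" where
  "dterm M \<iota> k x n = dpre M \<iota> k x n * rho (x (k * M + \<iota> k))
     + of_bool (n = k * M + \<iota> k) * (pre M \<iota> k x * rho' (x (k * M + \<iota> k)))"

text \<open>The quadratic pulls every coordinate to 0, while the \<open>k\<close>-th product rewards
  a large hidden coordinate in block \<open>k\<close>, but only as far as block \<open>k - 1\<close>
  is close to its target.\<close>

definition chain :: "nat \<Rightarrow> nat \<Rightarrow> (nat \<Rightarrow> nat) \<Rightarrow> vect \<Rightarrow> real" where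
  "chain M K \<iota> x = (\<Sum>n<K * M. (x n)\<^sup>2 / 2) - (\<Sum>k<K. pre M \<iota> k x * rho (x (k * M + \<iota> k)))"

definition chain_grad :: "nat \<Rightarrow> nat \<Rightarrow> (nat \<Rightarrow> nat) \<Rightarrow> vect \<Rightarrow> vect" where
  "chain_grad M K \<iota> x n = x n - (\<Sum>k<K. dterm M \<iota> k x n)"

lemma pre_bounds: "0 \<le> pre M \<iota> k x" "pre M \<iota> k x \<le> 1"
  by (cases k; simp add: gate_bounds)+

lemma L2_set_of_bool: "finite A \<Longrightarrow> i \<in> A \<Longrightarrow> L2_set (\<lambda>l. of_bool (l = i) * b) A = \<bar>b\<bar>"
  by (simp add: L2_set_def power_mult_distrib of_bool_def if_distrib[of "\<lambda>x. x\<^sup>2"]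
      if_distrib[of "\<lambda>x. x * _"] cong: if_cong)

lemma L2_set_triangle3: "L2_set (\<lambda>l. f l + g l + h l) A \<le> L2_set f A + L2_set g A + L2_set h A"
  using L2_set_triangle_ineq[of "\<lambda>l. f l + g l" h A] L2_set_triangle_ineq[of f g A] by linarith

locale chain_index =
  fixes M K :: nat and \<iota> :: "nat \<Rightarrow> nat"
  assumes idx: "\<And>k. k < K \<Longrightarrow> \<iota> k < M" and K: "0 < K"
begin

abbreviation "y k x \<equiv> x (k * M + \<iota> k)"
abbreviation "G \<equiv> chain_grad M K \<iota>"

lemma coord_less: "k < K \<Longrightarrow> l < M \<Longrightarrow> k * M + l < K * M"
proof -
  assume "k < K" "l < M"
  then have "k * M + l < Suc k * M" "Suc k * M \<le> K * M" by (simp, intro mult_le_mono1, simp)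
  then show ?thesis by linarith
qed

lemma DERIV_dev:
  "((\<lambda>t. dev M \<iota> k (\<lambda>i. x i + t * v i)) has_real_derivative
     (\<Sum>l<M. 2 * dv M \<iota> k (\<lambda>i. x i + t * v i) l * v (k * M + l))) (at t)"
  unfolding dev_def dv_def by (auto intro!: derivative_eq_intros sum.cong)

lemma DERIV_pre:
  assumes "k < K"
  shows "((\<lambda>t. pre M \<iota> k (\<lambda>i. x i + t * v i)) has_real_derivative
     (\<Sum>n<K * M. dpre M \<iota> k (\<lambda>i. x i + t * v i) n * v n)) (at t)"
proof (cases k)
  case (Suc j)
  let ?x = "\<lambda>i. x i + t * v i"
  have "((\<lambda>t. gate (dev M \<iota> j (\<lambda>i. x i + t * v i))) has_real_derivative
     (- 8 * tent (8 * dev M \<iota> j ?x - 2)) * (\<Sum>l<M. 2 * dv M \<iota> j ?x l * v (j * M + l))) (at t)"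
    by (rule DERIV_chain2[OF DERIV_gate DERIV_dev])
  also have "(- 8 * tent (8 * dev M \<iota> j ?x - 2)) * (\<Sum>l<M. 2 * dv M \<iota> j ?x l * v (j * M + l))
      = (\<Sum>l<M. - 16 * radial {..<M} (dv M \<iota> j ?x) l * v (j * M + l))"
    unfolding sum_distrib_left radial_def dev_def by (intro sum.cong) auto
  also have "\<dots> = (\<Sum>n<K * M. if n div M = j then - 16 * radial {..<M} (dv M \<iota> j ?x) (n mod M) * v n else 0)"
    using assms Suc by (subst sum_one_block) auto
  also have "\<dots> = (\<Sum>n<K * M. dpre M \<iota> k ?x n * v n)"
    unfolding Suc by (intro sum.cong) auto
  finally show ?thesis by (simp add: Suc)
qed simp

lemma DERIV_chain_line:
  "((\<lambda>t. chain M K \<iota> (\<lambda>i. x i + t * v i)) has_real_derivative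
     (\<Sum>n<K * M. G (\<lambda>i. x i + t * v i) n * v n)) (at t)"
proof -
  let ?x = "\<lambda>i. x i + t * v i"
  have T: "((\<lambda>t. pre M \<iota> k (\<lambda>i. x i + t * v i) * rho (y k (\<lambda>i. x i + t * v i))) has_real_derivative
     (\<Sum>n<K * M. dterm M \<iota> k ?x n * v n)) (at t)" if k: "k < K" for k
  proof -
    have s: "(\<Sum>n<K * M. of_bool (n = k * M + \<iota> k) * (c * v n)) = c * y k v" for c
      using coord_less[OF k idx[OF k]] by (simp add: of_bool_def if_distrib[of "\<lambda>x. x * _"] cong: if_cong)
    have "((\<lambda>t. x (k * M + \<iota> k) + t * v (k * M + \<iota> k)) has_real_derivative y k v) (at t)"
      by (auto intro!: derivative_eq_intros)
    then have "((\<lambda>t. rho (x (k * M + \<iota> k) + t * v (k * M + \<iota> k))) has_real_derivative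
        rho' (y k ?x) * y k v) (at t)"
      by (rule DERIV_chain2[OF DERIV_rho])
    then have "((\<lambda>t. pre M \<iota> k (\<lambda>i. x i + t * v i) * rho (y k (\<lambda>i. x i + t * v i))) has_real_derivative
      (\<Sum>n<K * M. dpre M \<iota> k ?x n * v n) * rho (y k ?x) + (rho' (y k ?x) * y k v) * pre M \<iota> k ?x) (at t)"
      by (rule DERIV_mult[OF DERIV_pre[OF k]])
    moreover have "(\<Sum>n<K * M. dpre M \<iota> k ?x n * v n) * rho (y k ?x) + (rho' (y k ?x) * y k v) * pre M \<iota> k ?x
        = (\<Sum>n<K * M. dterm M \<iota> k ?x n * v n)"
      using s[of "pre M \<iota> k ?x * rho' (y k ?x)"]
      by (simp add: dterm_def sum.distrib distrib_right distrib_left sum_distrib_right sum_distrib_left mult_ac)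
    ultimately show ?thesis by simp
  qed
  have "((\<lambda>t. chain M K \<iota> (\<lambda>i. x i + t * v i)) has_real_derivative
     (\<Sum>n<K * M. ?x n * v n) - (\<Sum>k<K. \<Sum>n<K * M. dterm M \<iota> k ?x n * v n)) (at t)"
    unfolding chain_def using T
    by (intro DERIV_diff DERIV_sum) (auto intro!: derivative_eq_intros)
  also have "(\<Sum>k<K. \<Sum>n<K * M. dterm M \<iota> k ?x n * v n) = (\<Sum>n<K * M. (\<Sum>k<K. dterm M \<iota> k ?x n) * v n)"
    by (subst sum.swap) (simp add: sum_distrib_right)
  finally show ?thesis
    by (simp add: chain_grad_def left_diff_distrib sum_subtractf)
qed

text \<open>The factor with which the slope of the gate of the next block enters the gradient in
  block \<open>k\<close>; the last block has no successor.\<close>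

definition nxt :: "nat \<Rightarrow> vect \<Rightarrow> real" where
  "nxt k x = (if Suc k < K then rho (y (Suc k) x) else 0)"

lemma nxt_bounds: "0 \<le> nxt k x" "nxt k x \<le> 7"
  by (auto simp: nxt_def rho_bounds)

text \<open>Only two terms of the chain depend on block \<open>k\<close>: its own through the hidden
  coordinate, and the next one through its gate. Hence the gradient there depends on at most three
  neighbouring blocks.\<close>

lemma chain_grad_block:
  assumes k: "k < K" and l: "l < M"
  shows "G x (k * M + l) = x (k * M + l) - of_bool (l = \<iota> k) * (pre M \<iota> k x * rho' (y k x))
     + 16 * nxt k x * radial {..<M} (dv M \<iota> k x) l"
proof -
  have A: "dpre M \<iota> j x (k * M + l) * rho (y j x) =
      (if j = Suc k then - 16 * radial {..<M} (dv M \<iota> k x) l * rho (y (Suc k) x) else 0)" for j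
    using l by (cases j) auto
  have B: "(k * M + l = j * M + \<iota> j) = (j = k \<and> l = \<iota> k)" if "j < K" for j
  proof
    assume *: "k * M + l = j * M + \<iota> j"
    then have "(k * M + l) div M = (j * M + \<iota> j) div M" by simp
    with idx[OF that] l have "j = k" by simp
    with * show "j = k \<and> l = \<iota> k" by simp
  qed simp
  have "(\<Sum>j<K. dterm M \<iota> j x (k * M + l)) =
      (\<Sum>j<K. if j = Suc k then - 16 * radial {..<M} (dv M \<iota> k x) l * rho (y (Suc k) x) else 0)
      + (\<Sum>j<K. if j = k then of_bool (l = \<iota> k) * (pre M \<iota> k x * rho' (y k x)) else 0)"
    unfolding dterm_def A sum.distrib[symmetric] by (intro sum.cong) (auto simp: B)
  also have "\<dots> = - 16 * nxt k x * radial {..<M} (dv M \<iota> k x) l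
      + of_bool (l = \<iota> k) * (pre M \<iota> k x * rho' (y k x))"
    using k by (simp add: nxt_def)
  finally show ?thesis by (simp add: chain_grad_def)
qed

section \<open>Lipschitz continuity of the gradient with a constant independent of \<open>K\<close>
  and \<open>M\<close>\<close>

definition bd :: "nat \<Rightarrow> vect \<Rightarrow> vect \<Rightarrow> real" where
  "bd k x z = L2_set (\<lambda>l. x (k * M + l) - z (k * M + l)) {..<M}"

lemma bd_nonneg: "0 \<le> bd k x z" by (simp add: bd_def)

lemma abs_head_diff: "k < K \<Longrightarrow> \<bar>y k x - y k z\<bar> \<le> bd k x z"
  unfolding bd_def using idx[of k]
    member_le_L2_set[of "{..<M}" "\<iota> k" "\<lambda>l. \<bar>x (k * M + l) - z (k * M + l)\<bar>"]
  by (simp add: L2_set_def)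

lemma L2_set_dv_diff: "L2_set (\<lambda>l. dv M \<iota> k x l - dv M \<iota> k z l) {..<M} = bd k x z"
  by (simp add: dv_def bd_def)

definition nb :: "nat \<Rightarrow> vect \<Rightarrow> vect \<Rightarrow> real" where
  "nb k x z = (case k of 0 \<Rightarrow> 0 | Suc j \<Rightarrow> bd j x z) + bd k x z + (if Suc k < K then bd (Suc k) x z else 0)"

text \<open>The three summands of \<open>chain_grad_block\<close> are estimated separately by the
  product rule. Here 32 = 16 * 2 and 1904 = 16 * 7 * 17, and the coefficient 1 + 2 + 1904 of the own
  block is below 2000.\<close>

lemma chain_grad_block_lipschitz:
  assumes k: "k < K"
  shows "L2_set (\<lambda>l. G x (k * M + l) - G z (k * M + l)) {..<M} \<le> 2000 * nb k x z"
proof -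
  let ?p = "case k of 0 \<Rightarrow> 0 | Suc j \<Rightarrow> bd j x z"
  let ?n = "if Suc k < K then bd (Suc k) x z else 0"
  let ?R = "\<lambda>x. radial {..<M} (dv M \<iota> k x)"
  let ?P = "\<lambda>x. pre M \<iota> k x * rho' (y k x)"
  have p0: "0 \<le> ?p" by (cases k) (auto simp: bd_nonneg)
  have n0: "0 \<le> ?n" by (auto simp: bd_nonneg)
  have P: "\<bar>?P x - ?P z\<bar> \<le> 32 * ?p + 2 * bd k x z"
  proof -
    have "\<bar>pre M \<iota> k x - pre M \<iota> k z\<bar> \<le> 16 * ?p"
    proof (cases k)
      case (Suc j)
      show ?thesis
        using gate_sum_squares_lipschitz[of "dv M \<iota> j x" "{..<M}" "dv M \<iota> j z"]
        by (simp add: Suc dev_def L2_set_dv_diff)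
    qed simp
    moreover have "\<bar>rho' (y k x) - rho' (y k z)\<bar> \<le> 2 * bd k x z"
      by (rule order_trans[OF rho'_lipschitz]) (simp add: abs_head_diff[OF k])
    moreover have "?P x - ?P z = (pre M \<iota> k x - pre M \<iota> k z) * rho' (y k x)
        + pre M \<iota> k z * (rho' (y k x) - rho' (y k z))" by (simp add: algebra_simps)
    then have "\<bar>?P x - ?P z\<bar> \<le> \<bar>pre M \<iota> k x - pre M \<iota> k z\<bar> * \<bar>rho' (y k x)\<bar>
        + \<bar>pre M \<iota> k z\<bar> * \<bar>rho' (y k x) - rho' (y k z)\<bar>"
      by (metis abs_mult abs_triangle_ineq)
    moreover have "\<dots> \<le> (16 * ?p) * 2 + 1 * (2 * bd k x z)"
      using calculation rho'_bounds pre_bounds bd_nonneg p0 by (intro add_mono mult_mono) auto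
    ultimately show ?thesis by linarith
  qed
  have N: "\<bar>nxt k x - nxt k z\<bar> \<le> 2 * ?n"
    using rho_lipschitz[of "y (Suc k) x" "y (Suc k) z"] abs_head_diff[of "Suc k" x z]
    by (auto simp: nxt_def)
  have Rd: "L2_set (\<lambda>l. ?R x l - ?R z l) {..<M} \<le> 17 * bd k x z"
    using radial_lipschitz[of "{..<M}" "dv M \<iota> k x" "dv M \<iota> k z"] by (simp add: L2_set_dv_diff)
  have NR: "L2_set (\<lambda>l. 16 * nxt k x * ?R x l - 16 * nxt k z * ?R z l) {..<M}
      \<le> 1904 * bd k x z + 32 * ?n"
  proof -
    have "L2_set (\<lambda>l. 16 * nxt k x * ?R x l - 16 * nxt k z * ?R z l) {..<M}
      = L2_set (\<lambda>l. 16 * nxt k x * (?R x l - ?R z l) + 16 * (nxt k x - nxt k z) * ?R z l) {..<M}"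
      by (simp add: algebra_simps)
    also have "\<dots> \<le> \<bar>16 * nxt k x\<bar> * L2_set (\<lambda>l. ?R x l - ?R z l) {..<M}
        + \<bar>16 * (nxt k x - nxt k z)\<bar> * L2_set (?R z) {..<M}"
      unfolding L2_set_scale[symmetric] by (rule L2_set_triangle_ineq)
    also have "\<dots> \<le> (16 * 7) * (17 * bd k x z) + (16 * (2 * ?n)) * 1"
      using Rd N nxt_bounds[of k x] L2_set_radial[of "{..<M}" "dv M \<iota> k z"] n0
      by (intro add_mono mult_mono) (auto simp: abs_mult)
    finally show ?thesis by simp
  qed
  have "L2_set (\<lambda>l. G x (k * M + l) - G z (k * M + l)) {..<M} =
    L2_set (\<lambda>l. (x (k * M + l) - z (k * M + l)) + of_bool (l = \<iota> k) * (?P z - ?P x)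
      + (16 * nxt k x * ?R x l - 16 * nxt k z * ?R z l)) {..<M}"
  proof (intro L2_set_cong refl)
    fix l assume "l \<in> {..<M}"
    then have l: "l < M" by simp
    show "G x (k * M + l) - G z (k * M + l) =
      (x (k * M + l) - z (k * M + l)) + of_bool (l = \<iota> k) * (?P z - ?P x)
      + (16 * nxt k x * ?R x l - 16 * nxt k z * ?R z l)"
      unfolding chain_grad_block[OF k l] by (simp add: right_diff_distrib)
  qed
  also have "\<dots> \<le> bd k x z + \<bar>?P z - ?P x\<bar> + (1904 * bd k x z + 32 * ?n)"
    using NR idx[OF k]
    by (intro order_trans[OF L2_set_triangle3] add_mono) (auto simp: L2_set_of_bool bd_def)
  also have "\<dots> \<le> 2000 * nb k x z"
    using P p0 n0 bd_nonneg[of k x z] unfolding nb_def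
    by (simp add: abs_minus_commute)
  finally show ?thesis .
qed

lemma power2_sum3_le: "(a + b + c)\<^sup>2 \<le> 3 * (a\<^sup>2 + b\<^sup>2 + (c::real)\<^sup>2)"
proof -
  have "0 \<le> (a - b)\<^sup>2 + (b - c)\<^sup>2 + (a - c)\<^sup>2" by simp
  then show ?thesis by (simp add: power2_eq_square algebra_simps)
qed

text \<open>One factor 3 comes from squaring a sum of three distances, the other from each block
  being a neighbour, or itself, at most three times.\<close>

lemma sum_nb_power2: "(\<Sum>k<K. (nb k x z)\<^sup>2) \<le> 9 * (\<Sum>k<K. (bd k x z)\<^sup>2)"
proof -
  let ?f = "\<lambda>k. (bd k x z)\<^sup>2"
  obtain J where J: "K = Suc J" using K by (cases K) auto
  have "(\<Sum>k<K. (nb k x z)\<^sup>2) \<le> (\<Sum>k<K. 3 * ((case k of 0 \<Rightarrow> 0 | Suc j \<Rightarrow> ?f j) + ?f k + (if Suc k < K then ?f (Suc k) else 0)))"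
  proof (intro sum_mono)
    fix k
    show "(nb k x z)\<^sup>2 \<le> 3 * ((case k of 0 \<Rightarrow> 0 | Suc j \<Rightarrow> ?f j) + ?f k + (if Suc k < K then ?f (Suc k) else 0))"
      unfolding nb_def by (rule order_trans[OF power2_sum3_le]) (simp split: nat.split)
  qed
  also have "\<dots> = 3 * ((\<Sum>k<K. case k of 0 \<Rightarrow> 0 | Suc j \<Rightarrow> ?f j) + (\<Sum>k<K. ?f k) + (\<Sum>k<K. if Suc k < K then ?f (Suc k) else 0))"
    by (simp add: sum.distrib sum_distrib_left)
  also have "(\<Sum>k<K. case k of 0 \<Rightarrow> 0 | Suc j \<Rightarrow> ?f j) \<le> (\<Sum>k<K. ?f k)"
    unfolding J sum.lessThan_Suc_shift[of "\<lambda>k. case k of 0 \<Rightarrow> 0 | Suc j \<Rightarrow> ?f j"] by simp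
  also have "(\<Sum>k<K. if Suc k < K then ?f (Suc k) else 0) = (\<Sum>k<J. ?f (Suc k))"
    unfolding J by simp
  also have "\<dots> \<le> (\<Sum>k<K. ?f k)"
    unfolding J sum.lessThan_Suc_shift[of ?f] by simp
  finally show ?thesis by simp
qed

lemma L2_set_blocks: "(L2_set f {..<K * M})\<^sup>2 = (\<Sum>k<K. (L2_set (\<lambda>l. f (k * M + l)) {..<M})\<^sup>2)"
  unfolding L2_set_power2 by (rule sum_blocks)

lemma chain_grad_lipschitz:
  "L2_set (\<lambda>n. G x n - G z n) {..<K * M} \<le> 6000 * L2_set (\<lambda>n. x n - z n) {..<K * M}"
proof (rule power2_le_imp_le)
  have "(L2_set (\<lambda>n. G x n - G z n) {..<K * M})\<^sup>2 \<le> (\<Sum>k<K. (2000 * nb k x z)\<^sup>2)"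
    unfolding L2_set_blocks
    by (intro sum_mono power_mono chain_grad_block_lipschitz) auto
  also have "\<dots> = 2000\<^sup>2 * (\<Sum>k<K. (nb k x z)\<^sup>2)"
    by (simp add: power_mult_distrib sum_distrib_left)
  also have "\<dots> \<le> 2000\<^sup>2 * (9 * (\<Sum>k<K. (bd k x z)\<^sup>2))"
    by (intro mult_left_mono sum_nb_power2) simp
  also have "\<dots> = (6000 * L2_set (\<lambda>n. x n - z n) {..<K * M})\<^sup>2"
    by (simp add: power_mult_distrib L2_set_blocks bd_def)
  finally show "(L2_set (\<lambda>n. G x n - G z n) {..<K * M})\<^sup>2 \<le> (6000 * L2_set (\<lambda>n. x n - z n) {..<K * M})\<^sup>2" .
qed simp

section \<open>Values of the chain and the Polyak-Lojasiewicz inequality\<close>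

lemma chain_eq_blocks:
  "chain M K \<iota> x + real K * (rho 1 - 1/2) =
    (\<Sum>k<K. (\<Sum>l<M. (x (k * M + l))\<^sup>2 / 2) - pre M \<iota> k x * rho (y k x) + (rho 1 - 1/2))"
  unfolding chain_def sum_blocks by (simp add: sum.distrib sum_subtractf)

lemma sum_squares_block:
  assumes "k < K"
  shows "(\<Sum>l<M. (x (k * M + l))\<^sup>2) = dev M \<iota> k x + (y k x)\<^sup>2 - (y k x - 1)\<^sup>2"
proof -
  have "(\<Sum>l<M. (x (k * M + l))\<^sup>2) - dev M \<iota> k x =
      (\<Sum>l<M. if l = \<iota> k then (y k x)\<^sup>2 - (y k x - 1)\<^sup>2 else 0)"
    unfolding dev_def sum_subtractf[symmetric] dv_def by (intro sum.cong) auto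
  then show ?thesis using idx[OF assms] by simp
qed

lemma head_power2_le:
  assumes "k < K"
  shows "(y k x)\<^sup>2 \<le> (\<Sum>l<M. (x (k * M + l))\<^sup>2)" and "(y k x - 1)\<^sup>2 \<le> dev M \<iota> k x"
  using member_le_sum[of "\<iota> k" "{..<M}" "\<lambda>l. (x (k * M + l))\<^sup>2"]
    member_le_sum[of "\<iota> k" "{..<M}" "\<lambda>l. (dv M \<iota> k x l)\<^sup>2"] idx[OF assms]
  by (auto simp: dev_def dv_def)

text \<open>As \<open>rho\<close> is nonnegative, a fully open gate is the worst case; keeping only
  the hidden coordinate of the quadratic reduces the claim to \<open>head_min\<close>.\<close>

lemma block_value_ge:
  assumes k: "k < K"
  shows "0 \<le> (\<Sum>l<M. (x (k * M + l))\<^sup>2 / 2) - pre M \<iota> k x * rho (y k x) + (rho 1 - 1/2)"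
proof -
  have "pre M \<iota> k x * rho (y k x) \<le> 1 * rho (y k x)"
    by (intro mult_right_mono pre_bounds rho_bounds)
  then show ?thesis
    using head_min[of "y k x"] head_power2_le(1)[OF k, of x]
    by (simp add: sum_divide_distrib[symmetric])
qed

lemma chain_ge: "- real K * (rho 1 - 1/2) \<le> chain M K \<iota> x"
proof -
  have "0 \<le> chain M K \<iota> x + real K * (rho 1 - 1/2)"
    unfolding chain_eq_blocks by (intro sum_nonneg block_value_ge) auto
  then show ?thesis by simp
qed

text \<open>A block whose predecessor is not finished is switched off and stays \<open>rho 1 - 1/2\<close> above
  its minimum.\<close>

lemma chain_ge_unfinished:
  assumes m: "m < K" and unf: "\<And>k. m \<le> k \<Longrightarrow> k < K \<Longrightarrow> 1/2 \<le> dev M \<iota> k x"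
  shows "real (K - Suc m) * (rho 1 - 1/2) \<le> chain M K \<iota> x + real K * (rho 1 - 1/2)"
proof -
  \<comment> \<open>Block \<open>m\<close> is not counted: block \<open>m - 1\<close> may be
    finished, and then block \<open>m\<close> is switched on.\<close>
  have "real (K - Suc m) * (rho 1 - 1/2) = (\<Sum>k\<in>{m<..<K}. rho 1 - 1/2)"
    by simp
  also have "\<dots> \<le> (\<Sum>k\<in>{m<..<K}. (\<Sum>l<M. (x (k * M + l))\<^sup>2 / 2) - pre M \<iota> k x * rho (y k x) + (rho 1 - 1/2))"
  proof (intro sum_mono)
    fix k assume "k \<in> {m<..<K}"
    then obtain j where j: "k = Suc j" "m \<le> j" "j < K" by (cases k) auto
    then have "pre M \<iota> k x = 0" using unf[of j] by (simp add: gate_zero)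
    then show "rho 1 - 1/2 \<le> (\<Sum>l<M. (x (k * M + l))\<^sup>2 / 2) - pre M \<iota> k x * rho (y k x) + (rho 1 - 1/2)"
      by (simp add: sum_nonneg)
  qed
  also have "\<dots> \<le> chain M K \<iota> x + real K * (rho 1 - 1/2)"
    unfolding chain_eq_blocks by (intro sum_mono2) (auto simp del: sum_divide_distrib intro!: block_value_ge)
  finally show ?thesis .
qed

lemma chain_at_target:
  assumes t: "\<And>k l. k < K \<Longrightarrow> l < M \<Longrightarrow> x (k * M + l) = of_bool (l = \<iota> k)"
  shows "chain M K \<iota> x = - real K * (rho 1 - 1/2)"
proof -
  have dev: "dev M \<iota> k x = 0" if "k < K" for k using that by (simp add: dev_def dv_def t)
  have "chain M K \<iota> x + real K * (rho 1 - 1/2) = (\<Sum>k<K. 0)"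
    unfolding chain_eq_blocks
  proof (intro sum.cong refl)
    fix k assume "k \<in> {..<K}"
    then have k: "k < K" by simp
    have "pre M \<iota> k x = 1" using k by (cases k) (auto simp: dev gate_one)
    moreover have "(\<Sum>l<M. (x (k * M + l))\<^sup>2 / 2) = 1/2"
      using sum_squares_block[OF k, of x]
      by (simp add: sum_divide_distrib[symmetric] dev[OF k] t[OF k idx[OF k]])
    ultimately show "(\<Sum>l<M. (x (k * M + l))\<^sup>2 / 2) - pre M \<iota> k x * rho (y k x) + (rho 1 - 1/2) = 0"
      by (simp add: t[OF k idx[OF k]])
  qed
  then show ?thesis by simp
qed

text \<open>Together with \<open>chain_ge\<close> this bounds the initial gap by
  \<open>real K * (rho 1 - 1/2)\<close>.\<close>

lemma chain_zero: "chain M K \<iota> (\<lambda>i. zero_Rn (K * M) i / \<beta>) \<le> 0"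
proof -
  have "0 \<le> (\<Sum>k<K. pre M \<iota> k z * rho (y k z))" for z
    by (intro sum_nonneg mult_nonneg_nonneg pre_bounds rho_bounds)
  then show ?thesis by (simp add: chain_def zero_Rn_def)
qed

text \<open>The gradient is tested against the displacement from the target. With an open gate the
  quadratic and head parts give at least \<open>dev / 2\<close> by \<open>head_slope\<close>, and
  the gate of the next block adds a nonnegative amount since its slope points along the
  displacement. Cauchy-Schwarz concludes.\<close>

lemma dev_le_grad:
  assumes k: "k < K" and p: "pre M \<iota> k x = 1"
  shows "dev M \<iota> k x \<le> 4 * (\<Sum>l<M. (G x (k * M + l))\<^sup>2)"
proof -
  let ?s = "L2_set (dv M \<iota> k x) {..<M}" and ?g = "L2_set (\<lambda>l. G x (k * M + l)) {..<M}"
  have s: "?s\<^sup>2 = dev M \<iota> k x" by (simp add: L2_set_power2 dev_def)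
  have s0: "0 \<le> ?s" by simp
  have "dev M \<iota> k x / 2 = (\<Sum>l<M. (dv M \<iota> k x l)\<^sup>2 / 2)"
    by (simp add: dev_def sum_divide_distrib)
  also have "\<dots> \<le> (\<Sum>l<M. G x (k * M + l) * dv M \<iota> k x l)"
  proof (intro sum_mono)
    fix l assume "l \<in> {..<M}"
    then have l: "l < M" by simp
    have "0 \<le> 16 * nxt k x * (tent (8 * (\<Sum>l<M. (dv M \<iota> k x l)\<^sup>2) - 2) * (dv M \<iota> k x l)\<^sup>2)"
      using nxt_bounds tent_bounds by simp
    then have r: "0 \<le> 16 * nxt k x * radial {..<M} (dv M \<iota> k x) l * dv M \<iota> k x l"
      by (simp add: radial_def power2_eq_square mult.assoc)
    have "(dv M \<iota> k x l)\<^sup>2 / 2 \<le> (x (k * M + l) - of_bool (l = \<iota> k) * rho' (y k x)) * dv M \<iota> k x l"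
    proof (cases "l = \<iota> k")
      case True
      then show ?thesis using head_slope[of "y k x"] by (simp add: dv_def)
    next
      case False
      then show ?thesis by (simp add: dv_def power2_eq_square)
    qed
    with r show "(dv M \<iota> k x l)\<^sup>2 / 2 \<le> G x (k * M + l) * dv M \<iota> k x l"
      unfolding chain_grad_block[OF k l] p distrib_right[of _ "16 * _ * _"] mult_1_left by linarith
  qed
  also have "\<dots> \<le> ?g * ?s" by (rule abs_le_D1[OF sum_mult_le_L2_set])
  finally have "?s * ?s \<le> (2 * ?g) * ?s" unfolding s[symmetric] by (simp add: power2_eq_square)
  then have "?s \<le> 2 * ?g" using s0 by (cases "?s = 0") (auto simp: less_le)
  then have "?s\<^sup>2 \<le> (2 * ?g)\<^sup>2" using s0 by (rule power_mono)
  then show ?thesis unfolding s by (simp add: power_mult_distrib L2_set_power2)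
qed

text \<open>Solving \<open>chain_grad_block\<close> for \<open>x\<close> leaves the gradient and a
  bounded remainder of norm at most 2 + 16 * 7 = 114; the constant is twice the square of
  114.\<close>

lemma sum_squares_block_le:
  assumes k: "k < K"
  shows "(\<Sum>l<M. (x (k * M + l))\<^sup>2) \<le> 2 * (\<Sum>l<M. (G x (k * M + l))\<^sup>2) + 25992"
proof -
  let ?g = "L2_set (\<lambda>l. G x (k * M + l)) {..<M}"
  let ?P = "pre M \<iota> k x * rho' (y k x)"
  let ?R = "radial {..<M} (dv M \<iota> k x)"
  have "L2_set (\<lambda>l. x (k * M + l)) {..<M} =
      L2_set (\<lambda>l. G x (k * M + l) + of_bool (l = \<iota> k) * ?P + (- 16 * nxt k x) * ?R l) {..<M}"
  proof (intro L2_set_cong refl)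
    fix l assume "l \<in> {..<M}"
    then have l: "l < M" by simp
    show "x (k * M + l) = G x (k * M + l) + of_bool (l = \<iota> k) * ?P + (- 16 * nxt k x) * ?R l"
      unfolding chain_grad_block[OF k l] by simp
  qed
  also have "\<dots> \<le> ?g + \<bar>?P\<bar> + \<bar>- 16 * nxt k x\<bar> * L2_set ?R {..<M}"
    by (rule order_trans[OF L2_set_triangle3])
       (simp only: L2_set_scale L2_set_of_bool[OF finite_lessThan] lessThan_iff idx[OF k] order_refl)
  also have "\<dots> \<le> ?g + 1 * 2 + (16 * 7) * 1"
    unfolding abs_mult using pre_bounds[of M \<iota> k x] rho'_bounds[of "y k x"] nxt_bounds[of k x] L2_set_radial
    by (intro add_mono mult_mono) auto
  finally have "(L2_set (\<lambda>l. x (k * M + l)) {..<M})\<^sup>2 \<le> (?g + 114)\<^sup>2"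
    by (intro power_mono) simp_all
  also have "\<dots> \<le> 2 * ?g\<^sup>2 + 25992"
  proof -
    have "0 \<le> (?g - 114)\<^sup>2" by simp
    then show ?thesis by (simp add: power2_eq_square algebra_simps)
  qed
  finally show ?thesis by (simp add: L2_set_power2)
qed

text \<open>If all blocks are near their targets, all gates are open and every block obeys its own
  inequality. Otherwise the first block that is not near has an open gate and a gradient bounded
  below, and this pays for the gap of all \<open>K\<close> blocks, whence the factor
  \<open>K\<close>.\<close>

lemma chain_PL:
  "chain M K \<iota> x + real K * (rho 1 - 1/2) \<le> 210000 * real K * (\<Sum>n<K * M. (G x n)\<^sup>2)"
proof -
  let ?N = "\<lambda>k. \<Sum>l<M. (G x (k * M + l))\<^sup>2"
  let ?S = "\<Sum>n<K * M. (G x n)\<^sup>2"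
  have SN: "?S = (\<Sum>k<K. ?N k)" by (rule sum_blocks)
  have N0: "0 \<le> ?N k" for k by (simp add: sum_nonneg)
  have S0: "0 \<le> ?S" by (simp add: sum_nonneg)
  have K1: "1 \<le> real K" using K by simp
  show ?thesis
  proof (cases "\<forall>k<K. dev M \<iota> k x \<le> 1/4")
    case True
    then have pre1: "pre M \<iota> k x = 1" if "k < K" for k using that by (cases k) (auto simp: gate_one)
    have "chain M K \<iota> x + real K * (rho 1 - 1/2) \<le> (\<Sum>k<K. 6 * ?N k)"
      unfolding chain_eq_blocks
    proof (intro sum_mono)
      fix k assume "k \<in> {..<K}"
      then have k: "k < K" by simp
      have "(\<Sum>l<M. (x (k * M + l))\<^sup>2 / 2) = dev M \<iota> k x / 2 + (y k x)\<^sup>2 / 2 - (y k x - 1)\<^sup>2 / 2"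
        using sum_squares_block[OF k, of x] by (simp add: sum_divide_distrib[symmetric])
      with head_max[of "y k x"] head_power2_le(2)[OF k, of x] dev_le_grad[OF k pre1[OF k]]
      show "(\<Sum>l<M. (x (k * M + l))\<^sup>2 / 2) - pre M \<iota> k x * rho (y k x) + (rho 1 - 1/2) \<le> 6 * ?N k"
        unfolding pre1[OF k] by linarith
    qed
    also have "\<dots> = 6 * ?S" unfolding SN by (simp add: sum_distrib_left)
    also have "\<dots> \<le> 210000 * real K * ?S" using K1 S0 by (intro mult_right_mono) auto
    finally show ?thesis .
  next
    case False
    \<comment> \<open>The first such block is taken, so that its predecessor is within 1/4 and opens
      its gate.\<close>
    then have "\<exists>k. k < K \<and> \<not> dev M \<iota> k x \<le> 1/4" by blast
    then obtain k where kK: "k < K" "\<not> dev M \<iota> k x \<le> 1/4"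
      and least: "\<forall>j<k. \<not> (j < K \<and> \<not> dev M \<iota> j x \<le> 1/4)"
      by (subst (asm) exists_least_iff) blast
    have before: "dev M \<iota> j x \<le> 1/4" if "j < k" for j
      using least that kK(1) by (meson less_trans)
    have "pre M \<iota> k x = 1" using before by (cases k) (auto simp: gate_one)
    then have "1/4 < 4 * ?N k" using dev_le_grad[OF kK(1)] kK(2) by fastforce
    moreover have "?N k \<le> ?S" unfolding SN using kK(1) N0 by (intro member_le_sum) auto
    ultimately have S16: "1 \<le> 16 * ?S" by linarith
    \<comment> \<open>13001 is half of 25992 plus 5, a bound for \<open>rho 1 - 1/2\<close>.\<close>
    have "chain M K \<iota> x + real K * (rho 1 - 1/2) \<le> (\<Sum>k<K. ?N k + 13001)"
      unfolding chain_eq_blocks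
    proof (intro sum_mono)
      fix k assume "k \<in> {..<K}"
      then have k: "k < K" by simp
      have "0 \<le> pre M \<iota> k x * rho (y k x)" by (intro mult_nonneg_nonneg pre_bounds rho_bounds)
      then show "(\<Sum>l<M. (x (k * M + l))\<^sup>2 / 2) - pre M \<iota> k x * rho (y k x) + (rho 1 - 1/2) \<le> ?N k + 13001"
        using sum_squares_block_le[OF k, of x] rho_1 by (simp add: sum_divide_distrib[symmetric])
    qed
    also have "\<dots> = 1 * ?S + 13001 * real K * 1" unfolding SN by (simp add: sum.distrib)
    also have "\<dots> \<le> real K * ?S + 13001 * real K * (16 * ?S)"
      using S16 S0 K1 by (intro add_mono mult_mono) auto
    also have "\<dots> \<le> 210000 * real K * ?S" using K1 S0 by simp
    finally show ?thesis .
  qed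
qed

text \<open>The gate part has norm at most 7 * 16 and the head part at most 2, together 114, whose
  square is 12996. A single term is thus bounded independently of \<open>K\<close> and
  \<open>M\<close>.\<close>

lemma dterm_norm:
  assumes k: "k < K"
  shows "(\<Sum>n<K * M. (dterm M \<iota> k x n)\<^sup>2) \<le> 12996"
proof -
  have "L2_set (dpre M \<iota> k x) {..<K * M} \<le> 16"
  proof (cases k)
    case 0
    then show ?thesis by (simp add: L2_set_def)
  next
    case (Suc j)
    have "(L2_set (dpre M \<iota> k x) {..<K * M})\<^sup>2 =
        (\<Sum>n<K * M. if n div M = j then (- 16 * radial {..<M} (dv M \<iota> j x) (n mod M))\<^sup>2 else 0)"
      unfolding L2_set_power2 Suc by (intro sum.cong) auto
    also have "\<dots> = (L2_set (\<lambda>l. - 16 * radial {..<M} (dv M \<iota> j x) l) {..<M})\<^sup>2"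
      using k Suc by (subst sum_one_block) (auto simp: L2_set_power2)
    also have "\<dots> = (16 * L2_set (radial {..<M} (dv M \<iota> j x)) {..<M})\<^sup>2"
      unfolding L2_set_scale by simp
    finally have "(L2_set (dpre M \<iota> k x) {..<K * M})\<^sup>2 = (16 * L2_set (radial {..<M} (dv M \<iota> j x)) {..<M})\<^sup>2" .
    then have "L2_set (dpre M \<iota> k x) {..<K * M} = 16 * L2_set (radial {..<M} (dv M \<iota> j x)) {..<M}"
      by (rule power2_eq_imp_eq) auto
    then show ?thesis using L2_set_radial[of "{..<M}" "dv M \<iota> j x"] by simp
  qed
  note dp = this
  have "L2_set (dterm M \<iota> k x) {..<K * M} \<le>
      L2_set (\<lambda>n. rho (y k x) * dpre M \<iota> k x n) {..<K * M} +
      L2_set (\<lambda>n. of_bool (n = k * M + \<iota> k) * (pre M \<iota> k x * rho' (y k x))) {..<K * M}"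
    unfolding dterm_def by (subst mult.commute[of "dpre _ _ _ _ _"]) (rule L2_set_triangle_ineq)
  also have "\<dots> = \<bar>rho (y k x)\<bar> * L2_set (dpre M \<iota> k x) {..<K * M} + \<bar>pre M \<iota> k x\<bar> * \<bar>rho' (y k x)\<bar>"
    using coord_less[OF k idx[OF k]] by (simp add: L2_set_scale L2_set_of_bool abs_mult)
  also have "\<dots> \<le> 7 * 16 + 1 * 2"
    using dp pre_bounds[of M \<iota> k x] rho'_bounds[of "y k x"] rho_bounds[of "y k x"]
    by (intro add_mono mult_mono) auto
  finally have "(L2_set (dterm M \<iota> k x) {..<K * M})\<^sup>2 \<le> 114\<^sup>2" by (intro power_mono) simp_all
  then show ?thesis by (simp add: L2_set_power2)
qed

end

section \<open>Known and hidden part of the gradient\<close>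

lemma tent_measurable[measurable]: "tent \<in> borel_measurable borel"
  unfolding tent_def[abs_def] by measurable

lemma gate_measurable[measurable]: "gate \<in> borel_measurable borel"
  unfolding gate_def[abs_def] by measurable

lemma rho_measurable[measurable]: "rho \<in> borel_measurable borel"
  by (intro borel_measurable_continuous_onI DERIV_continuous_on[where D=rho'])
     (auto intro: DERIV_rho has_field_derivative_at_within)

lemma rho'_measurable[measurable]: "rho' \<in> borel_measurable borel"
  unfolding rho'_def[abs_def] by measurable

text \<open>Terms after number \<open>stage\<close> are switched off, and those before it are given away for free,
  which keeps the norm of the hidden part bounded independently of \<open>K\<close>.\<close>

definition stage :: "nat \<Rightarrow> nat \<Rightarrow> (nat \<Rightarrow> nat) \<Rightarrow> vect \<Rightarrow> nat" where
  "stage M K \<iota> x = (LEAST j. \<forall>k<K. j \<le> k \<longrightarrow> 1/2 \<le> dev M \<iota> k x)"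

definition known_part :: "nat \<Rightarrow> nat \<Rightarrow> (nat \<Rightarrow> nat) \<Rightarrow> vect \<Rightarrow> vect" where
  "known_part M K \<iota> x n = x n - (\<Sum>k<K. if k < stage M K \<iota> x then dterm M \<iota> k x n else 0)"

definition hidden_part :: "nat \<Rightarrow> nat \<Rightarrow> (nat \<Rightarrow> nat) \<Rightarrow> vect \<Rightarrow> vect" where
  "hidden_part M K \<iota> x n = - (\<Sum>k<K. if k = stage M K \<iota> x then dterm M \<iota> k x n else 0)"

lemma stage_unfinished: "stage M K \<iota> x \<le> k \<Longrightarrow> k < K \<Longrightarrow> 1/2 \<le> dev M \<iota> k x"
proof -
  have "\<forall>k<K. stage M K \<iota> x \<le> k \<longrightarrow> 1/2 \<le> dev M \<iota> k x"
    unfolding stage_def by (rule LeastI[of _ K]) simp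
  then show "stage M K \<iota> x \<le> k \<Longrightarrow> k < K \<Longrightarrow> 1/2 \<le> dev M \<iota> k x" by blast
qed

lemma stage_le: "(\<And>k. k < K \<Longrightarrow> m \<le> k \<Longrightarrow> 1/2 \<le> dev M \<iota> k x) \<Longrightarrow> stage M K \<iota> x \<le> m"
  unfolding stage_def by (rule Least_le) blast

text \<open>The predecessor of such a block is at squared distance at least 1/2, where both the gate
  and its slope vanish.\<close>

lemma dterm_beyond_stage:
  assumes "stage M K \<iota> x < k" "k < K"
  shows "dterm M \<iota> k x n = 0"
proof -
  obtain j where j: "k = Suc j" using assms by (cases k) auto
  have "1/2 \<le> dev M \<iota> j x" using assms j by (intro stage_unfinished[of M K]) auto
  then show ?thesis by (simp add: dterm_def j gate_zero radial_zero dev_def)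
qed

lemma chain_grad_split: "chain_grad M K \<iota> x n = known_part M K \<iota> x n + hidden_part M K \<iota> x n"
proof -
  have "(\<Sum>k<K. dterm M \<iota> k x n) = (\<Sum>k<K. (if k < stage M K \<iota> x then dterm M \<iota> k x n else 0)
      + (if k = stage M K \<iota> x then dterm M \<iota> k x n else 0))"
    by (intro sum.cong) (auto intro!: dterm_beyond_stage)
  then show ?thesis
    by (simp only: chain_grad_def known_part_def hidden_part_def sum.distrib)
qed

lemma (in chain_index) hidden_part_norm: "(\<Sum>n<K * M. (hidden_part M K \<iota> x n)\<^sup>2) \<le> 12996"
proof (cases "stage M K \<iota> x < K")
  case True
  then have "hidden_part M K \<iota> x n = - dterm M \<iota> (stage M K \<iota> x) x n" for n
    by (simp add: hidden_part_def)
  then show ?thesis using dterm_norm[OF True, of x] by simp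
next
  case False
  then have "hidden_part M K \<iota> x n = 0" for n
    unfolding hidden_part_def by (subst sum.neutral) auto
  then show ?thesis by simp
qed

lemma dev_cong: "\<iota> k = \<kappa> k \<Longrightarrow> dev M \<iota> k x = dev M \<kappa> k x"
  by (simp add: dev_def dv_def)

lemma dterm_cong: "(\<And>j. j \<le> k \<Longrightarrow> \<iota> j = \<kappa> j) \<Longrightarrow> dterm M \<iota> k x n = dterm M \<kappa> k x n"
  by (cases k) (auto simp: dterm_def dv_def[abs_def] dev_cong[of \<iota> _ \<kappa>])

text \<open>This is what one answer can reveal. If all blocks from \<open>m\<close> on are
  unfinished, \<open>stage\<close> is at most \<open>m\<close>; term \<open>k\<close> depends only
  on the hidden indices \<open>k\<close> and \<open>k - 1\<close>, so the known part uses indices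
  below \<open>m\<close> and the hidden part at most index \<open>m\<close> in addition.\<close>

lemma
  assumes unf: "\<And>k. k < K \<Longrightarrow> m \<le> k \<Longrightarrow> 1/2 \<le> dev M \<iota> k x"
      "\<And>k. k < K \<Longrightarrow> m \<le> k \<Longrightarrow> 1/2 \<le> dev M \<kappa> k x"
    and eq: "\<And>k. k < m \<Longrightarrow> \<iota> k = \<kappa> k"
  shows stage_cong: "stage M K \<iota> x = stage M K \<kappa> x"
    and known_part_cong: "known_part M K \<iota> x n = known_part M K \<kappa> x n"
    and hidden_part_cong: "\<iota> m = \<kappa> m \<Longrightarrow> hidden_part M K \<iota> x n = hidden_part M K \<kappa> x n"
proof -
  \<comment> \<open>Below \<open>m\<close> the distances coincide, from \<open>m\<close> on both
    sides are true.\<close>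
  have "1/2 \<le> dev M \<iota> k x \<longleftrightarrow> 1/2 \<le> dev M \<kappa> k x" if "k < K" for k
    using unf[OF that] dev_cong[of \<iota> k \<kappa>, OF eq] by (cases "k < m") auto
  then show s: "stage M K \<iota> x = stage M K \<kappa> x" unfolding stage_def by metis
  have sm: "stage M K \<kappa> x \<le> m" using unf(2) by (rule stage_le)
  show "known_part M K \<iota> x n = known_part M K \<kappa> x n"
    unfolding known_part_def s using sm eq
    by (intro arg_cong2[of _ _ _ _ "(-)"] sum.cong if_cong dterm_cong refl) auto
  assume m: "\<iota> m = \<kappa> m"
  have "\<iota> k = \<kappa> k" if "k \<le> m" for k using that eq m by (cases "k = m") auto
  then show "hidden_part M K \<iota> x n = hidden_part M K \<kappa> x n"
    unfolding hidden_part_def s using sm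
    by (intro arg_cong[of _ _ uminus] sum.cong if_cong dterm_cong refl) auto
qed

lemma dev_small_unique:
  assumes "dev M \<iota> k x < 1/2" "dev M \<kappa> k x < 1/2" "\<iota> k < M" "\<kappa> k < M"
  shows "\<iota> k = \<kappa> k"
proof (rule ccontr)
  assume ne: "\<iota> k \<noteq> \<kappa> k"
  let ?a = "x (k * M + \<iota> k)" and ?b = "x (k * M + \<kappa> k)"
  have two: "(dv M \<mu> k x (\<iota> k))\<^sup>2 + (dv M \<mu> k x (\<kappa> k))\<^sup>2 \<le> dev M \<mu> k x" for \<mu>
  proof -
    have "(\<Sum>l\<in>{\<iota> k, \<kappa> k}. (dv M \<mu> k x l)\<^sup>2) \<le> dev M \<mu> k x"
      unfolding dev_def using assms by (intro sum_mono2) auto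
    then show ?thesis using ne by simp
  qed
  have "(?a - 1)\<^sup>2 + ?b\<^sup>2 < 1/2" "?a\<^sup>2 + (?b - 1)\<^sup>2 < 1/2"
    using two[of \<iota>] two[of \<kappa>] assms(1,2) ne by (auto simp: dv_def)
  \<comment> \<open>The left sides of the two strict inequalities add up to 1 plus half of this sum,
    hence to at least 1.\<close>
  moreover have "0 \<le> (2 * ?a - 1)\<^sup>2 + (2 * ?b - 1)\<^sup>2" by simp
  ultimately show False by (simp add: power2_eq_square algebra_simps)
qed

section \<open>Measurability in the query point\<close>

context chain_index
begin

text \<open>Everything is stated for a measurable point \<open>z w\<close>, which covers the
  rescaled point \<open>x / \<beta>\<close> of the final instance.\<close>

context
  fixes z :: "'a \<Rightarrow> vect" and N :: "'a measure"
  assumes z: "\<And>n. n < K * M \<Longrightarrow> (\<lambda>w. z w n) \<in> borel_measurable N"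
begin

lemma z_block_measurable:
  "k < K \<Longrightarrow> l < M \<Longrightarrow> (\<lambda>w. z w (k * M + l)) \<in> borel_measurable N"
  by (intro z coord_less)

lemma dv_measurable: "k < K \<Longrightarrow> l < M \<Longrightarrow> (\<lambda>w. dv M \<iota> k (z w) l) \<in> borel_measurable N"
  unfolding dv_def by (intro borel_measurable_diff z_block_measurable) auto

lemma dev_measurable: "k < K \<Longrightarrow> (\<lambda>w. dev M \<iota> k (z w)) \<in> borel_measurable N"
  unfolding dev_def by (intro borel_measurable_sum borel_measurable_power dv_measurable) auto

lemma pre_measurable: "k < K \<Longrightarrow> (\<lambda>w. pre M \<iota> k (z w)) \<in> borel_measurable N"
  by (cases k) (auto intro!: measurable_compose[OF dev_measurable gate_measurable])

lemma rho_head_measurable: "k < K \<Longrightarrow> (\<lambda>w. rho (y k (z w))) \<in> borel_measurable N"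
  by (intro measurable_compose[OF z_block_measurable rho_measurable] idx)

lemma chain_measurable: "(\<lambda>w. chain M K \<iota> (z w)) \<in> borel_measurable N"
  unfolding chain_def
  by (intro borel_measurable_diff borel_measurable_sum borel_measurable_divide borel_measurable_power
      borel_measurable_times pre_measurable rho_head_measurable z) auto

lemma dpre_measurable: "k < K \<Longrightarrow> n < K * M \<Longrightarrow> (\<lambda>w. dpre M \<iota> k (z w) n) \<in> borel_measurable N"
proof (cases k)
  case (Suc j)
  assume k: "k < K" "n < K * M"
  then have "0 < M" by (cases M) auto
  then have "n mod M < M" by simp
  then have "(\<lambda>w. - 16 * (tent (8 * dev M \<iota> j (z w) - 2) * dv M \<iota> j (z w) (n mod M))) \<in> borel_measurable N"
    using k Suc
    by (intro borel_measurable_times borel_measurable_const dv_measurable borel_measurable_diff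
        measurable_compose[OF _ tent_measurable] dev_measurable) auto
  then show ?thesis by (cases "n div M = j") (simp_all add: Suc radial_def dev_def)
qed simp

lemma dterm_measurable: "k < K \<Longrightarrow> n < K * M \<Longrightarrow> (\<lambda>w. dterm M \<iota> k (z w) n) \<in> borel_measurable N"
  unfolding dterm_def
  by (intro borel_measurable_add borel_measurable_times dpre_measurable rho_head_measurable
      borel_measurable_const pre_measurable
      measurable_compose[OF z_block_measurable rho'_measurable] idx)

lemma stage_measurable: "(\<lambda>w. stage M K \<iota> (z w)) \<in> N \<rightarrow>\<^sub>M count_space UNIV"
proof -
  have "Measurable.pred N (\<lambda>w. j \<le> k \<longrightarrow> 1/2 \<le> dev M \<iota> k (z w))" if "k \<in> {..<K}" for j k
  proof -
    have [measurable]: "(\<lambda>w. dev M \<iota> k (z w)) \<in> borel_measurable N"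
      using that by (intro dev_measurable) simp
    show ?thesis by (cases "j \<le> k") simp_all
  qed
  then have "Measurable.pred N (\<lambda>w. \<forall>k\<in>{..<K}. j \<le> k \<longrightarrow> 1/2 \<le> dev M \<iota> k (z w))" for j
    by (rule pred_intros_finite(3)[OF finite_lessThan])
  then have "Measurable.pred N (\<lambda>w. \<forall>k<K. j \<le> k \<longrightarrow> 1/2 \<le> dev M \<iota> k (z w))" for j
    unfolding Ball_def lessThan_iff .
  from measurable_Least[OF this] show ?thesis unfolding stage_def .
qed

lemma known_part_measurable:
  assumes n: "n < K * M"
  shows "(\<lambda>w. known_part M K \<iota> (z w) n) \<in> borel_measurable N"
proof -
  have "(\<lambda>w. if k < stage M K \<iota> (z w) then dterm M \<iota> k (z w) n else 0) \<in> borel_measurable N"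
    if "k \<in> {..<K}" for k
  proof -
    have "k < K" using that by simp
    note [measurable] = stage_measurable dterm_measurable[OF this n]
    show ?thesis by measurable
  qed
  then show ?thesis
    unfolding known_part_def by (intro borel_measurable_diff borel_measurable_sum z n)
qed

lemma hidden_part_measurable:
  assumes n: "n < K * M"
  shows "(\<lambda>w. hidden_part M K \<iota> (z w) n) \<in> borel_measurable N"
proof -
  have "(\<lambda>w. if k = stage M K \<iota> (z w) then dterm M \<iota> k (z w) n else 0) \<in> borel_measurable N"
    if "k \<in> {..<K}" for k
  proof -
    have "k < K" using that by simp
    note [measurable] = stage_measurable dterm_measurable[OF this n]
    show ?thesis by measurable
  qed
  then show ?thesis
    unfolding hidden_part_def by (intro borel_measurable_uminus borel_measurable_sum)
qed

end

text \<open>Rescaling multiplies the smoothness constant by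
  \<open>\<alpha> / \<beta>\<^sup>2\<close>, the Polyak-Lojasiewicz constant by
  \<open>\<beta>\<^sup>2 / \<alpha>\<close> and the gap by \<open>\<alpha>\<close>; the hypotheses
  say that the results fit into the class.\<close>

lemma
  fixes \<alpha> \<beta> :: real
  assumes ab: "0 < \<alpha>" "0 < \<beta>" and L: "6000 * \<alpha> \<le> L * \<beta>\<^sup>2"
    and \<tau>: "210000 * real K * \<beta>\<^sup>2 \<le> \<tau> * \<alpha>" and \<Delta>: "\<alpha> * real K * (rho 1 - 1/2) \<le> \<Delta>"
  shows scaled_chain_PL_class: "(\<lambda>x. \<alpha> * chain M K \<iota> (\<lambda>i. x i / \<beta>)) \<in> PL_class L \<tau> \<Delta> (K * M)"
    and scaled_chain_grad: "x \<in> Rn (K * M) \<Longrightarrow> grad (K * M) (\<lambda>x. \<alpha> * chain M K \<iota> (\<lambda>i. x i / \<beta>)) x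
      = restrict (\<lambda>n. \<alpha> / \<beta> * G (\<lambda>i. x i / \<beta>) n) {..<K * M}"
    and scaled_chain_inf: "inf_val (K * M) (\<lambda>x. \<alpha> * chain M K \<iota> (\<lambda>i. x i / \<beta>)) = - \<alpha> * real K * (rho 1 - 1/2)"
proof -
  let ?F = "\<lambda>x. \<alpha> * chain M K \<iota> (\<lambda>i. x i / \<beta>)"
  let ?g = "\<lambda>x n. \<alpha> / \<beta> * G (\<lambda>i. x i / \<beta>) n"
  \<comment> \<open>The minimiser: every block is \<open>\<beta>\<close> times its hidden unit
    vector.\<close>
  define x0 where "x0 = (\<lambda>n\<in>{..<K * M}. \<beta> * of_bool (n mod M = \<iota> (n div M)))"
  have line: "((\<lambda>t. ?F (\<lambda>i. x i + t * v i)) has_real_derivative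
      (\<Sum>n<K * M. ?g (\<lambda>i. x i + t * v i) n * v n)) (at t)" for x v t
    using DERIV_cmult[OF DERIV_chain_line[of "\<lambda>i. x i / \<beta>" "\<lambda>i. v i / \<beta>" t], of \<alpha>]
    by (simp add: add_divide_distrib sum_distrib_left mult_ac)
  have lip: "L2_set (\<lambda>n. ?g x n - ?g z n) {..<K * M} \<le> L * L2_set (\<lambda>n. x n - z n) {..<K * M}" for x z
  proof -
    let ?D = "L2_set (\<lambda>n. x n - z n) {..<K * M}"
    have "L2_set (\<lambda>n. ?g x n - ?g z n) {..<K * M} =
        \<alpha> / \<beta> * L2_set (\<lambda>n. G (\<lambda>i. x i / \<beta>) n - G (\<lambda>i. z i / \<beta>) n) {..<K * M}"
      unfolding right_diff_distrib[symmetric] L2_set_scale using ab by simp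
    also have "\<dots> \<le> \<alpha> / \<beta> * (6000 * L2_set (\<lambda>n. x n / \<beta> - z n / \<beta>) {..<K * M})"
      using ab by (intro mult_left_mono chain_grad_lipschitz) auto
    also have "(\<lambda>n. x n / \<beta> - z n / \<beta>) = (\<lambda>n. (1 / \<beta>) * (x n - z n))"
      by (auto simp: diff_divide_distrib)
    also have "\<alpha> / \<beta> * (6000 * L2_set (\<lambda>n. (1 / \<beta>) * (x n - z n)) {..<K * M}) = (6000 * \<alpha> / \<beta>\<^sup>2) * ?D"
      unfolding L2_set_scale using ab by (simp add: power2_eq_square)
    also have "\<dots> \<le> L * ?D" using L ab by (intro mult_right_mono) (auto simp: field_simps)
    finally show ?thesis .
  qed
  have L0: "0 \<le> L"
  proof (rule ccontr)
    assume "\<not> 0 \<le> L"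
    then have "L * \<beta>\<^sup>2 \<le> 0" by (simp add: mult_nonpos_nonneg)
    with L ab show False by linarith
  qed
  have m1: "- \<alpha> * real K * (rho 1 - 1/2) \<le> ?F x" for x
    using mult_left_mono[OF chain_ge[of "\<lambda>i. x i / \<beta>"], of \<alpha>] ab by (simp add: mult.assoc)
  have x0: "x0 \<in> Rn (K * M)" by (auto simp: x0_def)
  have "chain M K \<iota> (\<lambda>i. x0 i / \<beta>) = - real K * (rho 1 - 1/2)"
    using coord_less ab by (intro chain_at_target) (simp add: x0_def)
  then have m2: "?F x0 = - \<alpha> * real K * (rho 1 - 1/2)" by (simp add: mult.assoc)
  have init: "?F (zero_Rn (K * M)) - (- \<alpha> * real K * (rho 1 - 1/2)) \<le> \<Delta>"
    using mult_nonneg_nonpos[OF less_imp_le[OF ab(1)] chain_zero[of \<beta>]] \<Delta> by (simp add: mult.assoc)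
  have PL: "?F x - (- \<alpha> * real K * (rho 1 - 1/2)) \<le> \<tau> * (\<Sum>n<K * M. (?g x n)\<^sup>2)" for x
  proof -
    let ?S = "\<Sum>n<K * M. (G (\<lambda>i. x i / \<beta>) n)\<^sup>2"
    have S0: "0 \<le> ?S" by (simp add: sum_nonneg)
    have "?F x - (- \<alpha> * real K * (rho 1 - 1/2)) = \<alpha> * (chain M K \<iota> (\<lambda>i. x i / \<beta>) + real K * (rho 1 - 1/2))"
      by (simp add: algebra_simps)
    also have "\<dots> \<le> \<alpha> * (210000 * real K * ?S)"
      using ab by (intro mult_left_mono chain_PL) auto
    also have "\<dots> = (210000 * real K * \<beta>\<^sup>2) * (\<alpha> / \<beta>\<^sup>2 * ?S)" using ab by (simp add: field_simps)
    also have "\<dots> \<le> (\<tau> * \<alpha>) * (\<alpha> / \<beta>\<^sup>2 * ?S)" using \<tau> S0 ab by (intro mult_right_mono) auto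
    also have "\<dots> = \<tau> * (\<Sum>n<K * M. (?g x n)\<^sup>2)"
      by (simp only: power_mult_distrib sum_distrib_left[symmetric]) (simp add: power2_eq_square)
    finally show ?thesis .
  qed
  show "?F \<in> PL_class L \<tau> \<Delta> (K * M)"
    by (rule PL_class_lineI(1)[OF line lip L0 m1 x0 m2 init PL])
  show "grad (K * M) ?F x = restrict (?g x) {..<K * M}" if "x \<in> Rn (K * M)"
    by (rule PL_class_lineI(2)[OF line lip L0 m1 x0 m2 init PL that])
  show "inf_val (K * M) ?F = - \<alpha> * real K * (rho 1 - 1/2)"
    using m1 x0 m2 by (rule inf_val_eqI)
qed

end

section \<open>Counting lucky guesses\<close>

text \<open>By induction two runs with equal seed and noise coincide as long as the oracles agree at
  the points queried. The samples are compared only where the two query points are already known to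
  be equal.\<close>

lemma transcript_cong:
  assumes "\<And>s. s < t \<Longrightarrow> iterate A d G s r \<xi> = iterate A d G' s r \<xi> \<Longrightarrow>
    sample G (iterate A d G s r \<xi>) (\<xi> s) = sample G' (iterate A d G s r \<xi>) (\<xi> s)"
  shows "transcript A d G r \<xi> t = transcript A d G' r \<xi> t"
  using assms
proof (induction t)
  case (Suc t)
  then have "transcript A d G r \<xi> t = transcript A d G' r \<xi> t" by simp
  with Suc.prems[of t] show ?case by (simp add: iterate_def)
qed simp

lemma iterate_cong:
  assumes "\<And>s. s < t \<Longrightarrow> iterate A d G s r \<xi> = iterate A d G' s r \<xi> \<Longrightarrow>
    sample G (iterate A d G s r \<xi>) (\<xi> s) = sample G' (iterate A d G s r \<xi>) (\<xi> s)"
  shows "iterate A d G t r \<xi> = iterate A d G' t r \<xi>"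
  using transcript_cong[OF assms] by (simp add: iterate_def)

text \<open>At the first time \<open>t\<close> at which a stage \<open>k\<close> beyond the \<open>m t\<close> revealed ones is finished, the
  point \<open>X \<iota> t\<close> does not depend on \<open>\<iota> k\<close> but determines it. Hence a pair \<open>(t, k)\<close> accounts for at
  most \<open>M ^ (K - 1)\<close> indices.\<close>

lemma card_lucky_guesses:
  fixes unf :: "(nat \<Rightarrow> nat) \<Rightarrow> nat \<Rightarrow> 'x \<Rightarrow> bool" and M K :: nat
  defines "I \<equiv> {..<K} \<rightarrow>\<^sub>E {..<M}"
  assumes agree: "\<And>\<iota> \<kappa> t k. \<lbrakk>k < K; m t \<le> k; \<And>j. j \<noteq> k \<Longrightarrow> \<iota> j = \<kappa> j;
      \<And>s j. s < t \<Longrightarrow> j < K \<Longrightarrow> m s \<le> j \<Longrightarrow> unf \<iota> j (X \<iota> s) \<and> unf \<kappa> j (X \<kappa> s)\<rbrakk> \<Longrightarrow> X \<iota> t = X \<kappa> t"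
    and unique: "\<And>\<iota> \<kappa> k x. \<lbrakk>\<iota> \<in> I; \<kappa> \<in> I; k < K; \<not> unf \<iota> k x; \<not> unf \<kappa> k x\<rbrakk> \<Longrightarrow> \<iota> k = \<kappa> k"
  shows "card {\<iota> \<in> I. \<exists>t\<le>T. \<exists>k<K. m t \<le> k \<and> \<not> unf \<iota> k (X \<iota> t)} \<le> (T + 1) * K * M ^ (K - 1)"
proof -
  have fin: "finite I" unfolding I_def by (intro finite_PiE) auto
  define first where "first t k = {\<iota> \<in> I. m t \<le> k \<and>
    (\<forall>s<t. \<forall>j<K. m s \<le> j \<longrightarrow> unf \<iota> j (X \<iota> s)) \<and> \<not> unf \<iota> k (X \<iota> t)}" for t k
  have sub: "{\<iota> \<in> I. \<exists>t\<le>T. \<exists>k<K. m t \<le> k \<and> \<not> unf \<iota> k (X \<iota> t)} \<subseteq> (\<Union>(t, k)\<in>{..T} \<times> {..<K}. first t k)"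
  proof
    fix \<iota> assume "\<iota> \<in> {\<iota> \<in> I. \<exists>t\<le>T. \<exists>k<K. m t \<le> k \<and> \<not> unf \<iota> k (X \<iota> t)}"
    moreover define hit where "hit t \<longleftrightarrow> t \<le> T \<and> (\<exists>k<K. m t \<le> k \<and> \<not> unf \<iota> k (X \<iota> t))" for t
    ultimately have \<iota>: "\<iota> \<in> I" and "\<exists>t. hit t" by auto
    from this(2) obtain t where "hit t" and least: "\<And>s. s < t \<Longrightarrow> \<not> hit s"
      using exists_least_iff[of hit] by blast
    then have t: "t \<le> T" "\<exists>k<K. m t \<le> k \<and> \<not> unf \<iota> k (X \<iota> t)" by (auto simp: hit_def)
    from t(2) obtain k where k: "k < K" "m t \<le> k" "\<not> unf \<iota> k (X \<iota> t)" by blast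
    have "\<forall>s<t. \<forall>j<K. m s \<le> j \<longrightarrow> unf \<iota> j (X \<iota> s)"
      using least t(1) unfolding hit_def by (meson less_imp_le le_trans)
    with k \<iota> have "\<iota> \<in> first t k" by (simp add: first_def)
    with t(1) k(1) show "\<iota> \<in> (\<Union>(t, k)\<in>{..T} \<times> {..<K}. first t k)" by blast
  qed
  have "card (first t k) \<le> M ^ (K - 1)" if k: "k < K" for t k
  proof -
    \<comment> \<open>Forgetting the \<open>k\<close>-th entry is injective on
      \<open>first t k\<close>, which gives the exponent \<open>K - 1\<close>.\<close>
    let ?r = "\<lambda>\<iota>. restrict \<iota> ({..<K} - {k})"
    have "inj_on ?r (first t k)"
    proof (rule inj_onI)
      fix \<iota> \<kappa> assume F: "\<iota> \<in> first t k" "\<kappa> \<in> first t k" and r: "?r \<iota> = ?r \<kappa>"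
      then have I: "\<iota> \<in> I" "\<kappa> \<in> I" by (auto simp: first_def)
      have eq: "\<iota> j = \<kappa> j" if "j \<noteq> k" for j
      proof (cases "j < K")
        case True
        then show ?thesis using fun_cong[OF r, of j] that by simp
      next
        case False
        then show ?thesis using I by (auto simp: I_def PiE_def extensional_def)
      qed
      have "X \<iota> t = X \<kappa> t"
        using F k by (intro agree[of k t \<iota> \<kappa>] eq) (auto simp: first_def)
      then have "\<iota> k = \<kappa> k"
        using F by (intro unique[OF I k, of "X \<iota> t"]) (auto simp: first_def)
      then show "\<iota> = \<kappa>" using eq by (metis ext)
    qed
    moreover have "?r ` first t k \<subseteq> ({..<K} - {k}) \<rightarrow>\<^sub>E {..<M}"
      by (auto simp: first_def I_def PiE_iff split: if_splits)
    ultimately have "card (first t k) \<le> card (({..<K} - {k}) \<rightarrow>\<^sub>E {..<M})"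
      by (intro card_inj_on_le) (auto intro: finite_PiE)
    also have "\<dots> = M ^ (K - 1)" using k by (simp add: card_funcsetE)
    finally show ?thesis .
  qed
  then have "(\<Sum>(t, k)\<in>{..T} \<times> {..<K}. card (first t k)) \<le> (\<Sum>(t, k)\<in>{..T} \<times> {..<K}. M ^ (K - 1))"
    by (intro sum_mono) auto
  moreover have "card (\<Union>(t, k)\<in>{..T} \<times> {..<K}. first t k) \<le> (\<Sum>(t, k)\<in>{..T} \<times> {..<K}. card (first t k))"
    by (rule order_trans[OF card_UN_le]) (auto simp: split_beta')
  moreover have "card {\<iota> \<in> I. \<exists>t\<le>T. \<exists>k<K. m t \<le> k \<and> \<not> unf \<iota> k (X \<iota> t)} \<le> card (\<Union>(t, k)\<in>{..T} \<times> {..<K}. first t k)"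
    using fin by (intro card_mono sub) (auto simp: first_def)
  ultimately show ?thesis by simp
qed

text \<open>\<open>M\<close> is so large that at most a quarter of the indices are guessed by luck.
  For every other index fewer than \<open>m\<close>, half of \<open>K\<close>, stages are finished
  without interruption, so half of the full gap remains; 3/8 is 3/4 times 1/2.\<close>

lemma chain_average_gap:
  fixes \<alpha> \<beta> p :: real
  assumes \<alpha>: "0 < \<alpha>" and m: "0 < m" and few: "card {t. t < T \<and> \<xi> t = 1} < m"
  defines "K \<equiv> 2 * m"
  defines "M \<equiv> 4 * (T + 1) * K"
  defines "I \<equiv> {..<K} \<rightarrow>\<^sub>E {..<M}"
  defines "G \<equiv> \<lambda>\<iota>. bern_oracle p (K * M) (\<lambda>x n. \<alpha> / \<beta> * known_part M K \<iota> (\<lambda>i. x i / \<beta>) n)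
      (\<lambda>x n. \<alpha> / \<beta> * hidden_part M K \<iota> (\<lambda>i. x i / \<beta>) n)"
  shows "3/8 * (\<alpha> * real K * (rho 1 - 1/2)) * real (card I) \<le>
    (\<Sum>\<iota>\<in>I. \<alpha> * chain M K \<iota> (\<lambda>i. iterate A (K * M) (G \<iota>) T r \<xi> i / \<beta>) - (- \<alpha> * real K * (rho 1 - 1/2)))"
proof -
  define w where "w = rho 1 - 1/2"
  have w: "0 < w" using rho_1 by (simp add: w_def)
  have K: "0 < K" using m by (simp add: K_def)
  define X where "X \<iota> t = iterate A (K * M) (G \<iota>) t r \<xi>" for \<iota> t
  define unf where "unf \<iota> k x \<longleftrightarrow> 1/2 \<le> dev M \<iota> k (\<lambda>i. x i / \<beta>)" for \<iota> k and x :: vect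
  \<comment> \<open>The number of informative answers before time \<open>t\<close>, in the role of
    \<open>m t\<close> in \<open>card_lucky_guesses\<close>.\<close>
  define rv where "rv t = card {s. s < t \<and> \<xi> s = 1}" for t
  have rv_mono: "rv s \<le> rv t" if "s \<le> t" for s t
    unfolding rv_def using that by (intro card_mono) auto
  have rv_Suc: "rv (Suc s) = Suc (rv s)" if "\<xi> s = 1" for s
  proof -
    have "{t. t < Suc s \<and> \<xi> t = 1} = insert s {t. t < s \<and> \<xi> t = 1}" using that by auto
    then show ?thesis by (simp add: rv_def)
  qed
  have agree: "X \<iota> t = X \<kappa> t" if k: "k < K" "rv t \<le> k" and eq: "\<And>j. j \<noteq> k \<Longrightarrow> \<iota> j = \<kappa> j"
    and u: "\<And>s j. s < t \<Longrightarrow> j < K \<Longrightarrow> rv s \<le> j \<Longrightarrow> unf \<iota> j (X \<iota> s) \<and> unf \<kappa> j (X \<kappa> s)"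
    for \<iota> \<kappa> t k
    unfolding X_def
  proof (rule iterate_cong)
    fix s assume s: "s < t" and same: "iterate A (K * M) (G \<iota>) s r \<xi> = iterate A (K * M) (G \<kappa>) s r \<xi>"
    define xs where "xs = iterate A (K * M) (G \<iota>) s r \<xi>"
    let ?x = "\<lambda>i. xs i / \<beta>"
    have uu: "1/2 \<le> dev M \<iota> j ?x" "1/2 \<le> dev M \<kappa> j ?x" if "j < K" "rv s \<le> j" for j
      using u[OF s that] same by (auto simp: unf_def X_def xs_def)
    have le: "\<iota> j = \<kappa> j" if "j < rv s" for j
      using that rv_mono[of s t] s k by (intro eq) auto
    \<comment> \<open>An uninformative answer consists of the known part only, which agrees whatever
      the indices from \<open>rv s\<close> on are.\<close>
    have kn: "known_part M K \<iota> ?x n = known_part M K \<kappa> ?x n" for n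
      using uu le by (rule known_part_cong)
    have hd: "hidden_part M K \<iota> ?x n = hidden_part M K \<kappa> ?x n" if "\<xi> s = 1" for n
    proof (rule hidden_part_cong[OF uu le])
      \<comment> \<open>An informative answer at time \<open>s\<close> may use index
        \<open>rv s\<close>; it is itself counted in \<open>rv t\<close>, so this index lies below
        \<open>k\<close>, where the two choices agree.\<close>
      have "rv s < rv t" using rv_mono[of "Suc s" t] rv_Suc[OF that] s by simp
      with k show "\<iota> (rv s) = \<kappa> (rv s)" by (intro eq) simp
    qed
    show "sample (G \<iota>) (iterate A (K * M) (G \<iota>) s r \<xi>) (\<xi> s) = sample (G \<kappa>) (iterate A (K * M) (G \<iota>) s r \<xi>) (\<xi> s)"
      unfolding xs_def[symmetric] unfolding G_def bern_oracle_def by (auto simp: kn hd)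
  qed
  define B where "B = {\<iota> \<in> I. \<exists>t\<le>T. \<exists>k<K. rv t \<le> k \<and> \<not> unf \<iota> k (X \<iota> t)}"
  have "card B \<le> (T + 1) * K * M ^ (K - 1)"
    unfolding B_def I_def
  proof (rule card_lucky_guesses[OF agree])
    fix \<iota> \<kappa> k and x :: vect
    assume "\<iota> \<in> {..<K} \<rightarrow>\<^sub>E {..<M}" "\<kappa> \<in> {..<K} \<rightarrow>\<^sub>E {..<M}" "k < K" "\<not> unf \<iota> k x" "\<not> unf \<kappa> k x"
    then show "\<iota> k = \<kappa> k"
      by (intro dev_small_unique[of M _ _ "\<lambda>i. x i / \<beta>"]) (auto simp: unf_def PiE_def Pi_def)
  qed
  moreover have M4: "4 * ((T + 1) * K * P) = M * P" for P by (simp add: M_def algebra_simps)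
  ultimately have "4 * card B \<le> 4 * ((T + 1) * K * M ^ (K - 1))" by (intro mult_left_mono) auto
  also have "\<dots> = M * M ^ (K - 1)" by (rule M4)
  also have "\<dots> = card I" using K by (simp add: I_def card_funcsetE power_eq_if)
  finally have B4: "4 * real (card B) \<le> real (card I)" by linarith
  have fin: "finite I" unfolding I_def by (intro finite_PiE) auto
  have BI: "B \<subseteq> I" by (auto simp: B_def)
  let ?gap = "\<lambda>\<iota>. \<alpha> * chain M K \<iota> (\<lambda>i. X \<iota> T i / \<beta>) - (- \<alpha> * real K * w)"
  have gap: "?gap \<iota> = \<alpha> * (chain M K \<iota> (\<lambda>i. X \<iota> T i / \<beta>) + real K * w)" for \<iota>
    by (simp add: algebra_simps)
  have ci: "chain_index M K \<iota>" if "\<iota> \<in> I" for \<iota>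
    using that K by unfold_locales (auto simp: I_def)
  have "3/8 * (\<alpha> * real K * w) * real (card I) \<le> \<alpha> * (real K / 2) * w * real (card (I - B))"
  proof -
    have "3/4 * real (card I) \<le> real (card (I - B))"
      using B4 fin BI card_mono[OF fin BI] by (simp add: card_Diff_subset finite_subset of_nat_diff)
    then have "\<alpha> * (real K / 2) * w * (3/4 * real (card I)) \<le> \<alpha> * (real K / 2) * w * real (card (I - B))"
      using \<alpha> w by (intro mult_left_mono) auto
    then show ?thesis by simp
  qed
  also have "\<dots> = (\<Sum>\<iota>\<in>I - B. \<alpha> * (real K / 2 * w))" by simp
  also have "\<dots> \<le> (\<Sum>\<iota>\<in>I - B. ?gap \<iota>)"
  proof (rule sum_mono)
    fix \<iota> assume \<iota>: "\<iota> \<in> I - B"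
    interpret chain_index M K \<iota> using ci \<iota> by simp
    have rT: "rv T < m" using few by (simp add: rv_def)
    \<comment> \<open>Since \<open>rv T < m\<close>, at least \<open>m\<close> blocks remain
      switched off.\<close>
    have "real K / 2 * w \<le> real (K - Suc (rv T)) * w"
      using rT w by (intro mult_right_mono) (auto simp: K_def)
    also have "\<dots> \<le> chain M K \<iota> (\<lambda>i. X \<iota> T i / \<beta>) + real K * w"
      unfolding w_def using rT \<iota> by (intro chain_ge_unfinished) (auto simp: K_def B_def unf_def)
    finally show "\<alpha> * (real K / 2 * w) \<le> ?gap \<iota>"
      unfolding gap using \<alpha> by (intro mult_left_mono) auto
  qed
  also have "\<dots> \<le> (\<Sum>\<iota>\<in>I. ?gap \<iota>)"
  proof (intro sum_mono2 fin)
    fix \<iota> assume "\<iota> \<in> I - (I - B)"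
    then interpret chain_index M K \<iota> using ci by simp
    show "0 \<le> ?gap \<iota>"
      unfolding gap using \<alpha> chain_ge[of "\<lambda>i. X \<iota> T i / \<beta>"] by (simp add: w_def)
  qed auto
  finally show ?thesis unfolding X_def w_def .
qed

section \<open>Lower bounds in the two regimes of L \<tau>\<close>

lemma minimax_gap_chain:
  assumes pos: "0 < L" "0 < \<tau>" "0 < \<epsilon>" and m: "0 < m" and \<Delta>: "10 * \<epsilon> \<le> \<Delta>"
    and mL: "2520000000 * real m \<le> L * \<tau>"
    and p: "0 < p" "p \<le> 1" and T: "real T * p \<le> real m / 2"
    and v: "3 * L * \<epsilon> / real m * (1 / p - 1) \<le> v"
  shows "ennreal (3/2 * \<epsilon>) \<le> minimax_gap L \<tau> \<Delta> v T"
proof -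
  define K where "K = 2 * m"
  define M where "M = 4 * (T + 1) * K"
  define I where "I = {..<K} \<rightarrow>\<^sub>E {..<M}"
  define w where "w = rho 1 - 1/2"
  have w: "4 \<le> w" using rho_1 by (simp add: w_def)
  have K: "0 < K" "real K = 2 * real m" using m by (auto simp: K_def)
  have M: "0 < M" using K by (simp add: M_def)
  \<comment> \<open>The bound \<open>\<alpha> * real K * w\<close> on the initial gap becomes
    \<open>8 * \<epsilon>\<close>, which is below \<open>\<Delta>\<close>.\<close>
  define \<alpha> where "\<alpha> = 8 * \<epsilon> / (real K * w)"
  \<comment> \<open>The smallest scale allowed by the smoothness constraint, which then holds with
    equality.\<close>
  define \<beta> where "\<beta> = sqrt (6000 * \<alpha> / L)"
  have \<alpha>: "0 < \<alpha>" "\<alpha> * real K * w = 8 * \<epsilon>" using pos K w by (auto simp: \<alpha>_def)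
  have \<beta>: "0 < \<beta>" "\<beta>\<^sup>2 = 6000 * \<alpha> / L" using pos \<alpha> by (auto simp: \<beta>_def)
  have c1: "6000 * \<alpha> \<le> L * \<beta>\<^sup>2" using pos by (simp add: \<beta>)
  \<comment> \<open>The number 2520000000 in \<open>mL\<close> is 210000 * 2 * 6000.\<close>
  have c2: "210000 * real K * \<beta>\<^sup>2 \<le> \<tau> * \<alpha>"
  proof -
    have "2520000000 * real m * \<alpha> \<le> L * \<tau> * \<alpha>" using mL \<alpha> by (intro mult_right_mono) auto
    then show ?thesis unfolding \<beta> K(2) using pos by (simp add: field_simps)
  qed
  have c3: "\<alpha> * real K * (rho 1 - 1/2) \<le> \<Delta>" using \<alpha> \<Delta> pos by (simp add: w_def)
  have B: "(\<alpha> / \<beta>)\<^sup>2 * 12996 \<le> 3 * L * \<epsilon> / real m"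
  proof -
    have "\<alpha> * real K * 4 \<le> 8 * \<epsilon>"
      unfolding \<alpha>(2)[symmetric] using w \<alpha> by (intro mult_left_mono) auto
    then have "\<alpha> \<le> \<epsilon> / real m" using K m by (simp add: field_simps)
    then have "2.166 * L * \<alpha> \<le> 3 * L * (\<epsilon> / real m)"
      using pos \<alpha> by (intro mult_mono) auto
    moreover have "(\<alpha> / \<beta>)\<^sup>2 * 12996 = 2.166 * L * \<alpha>"
      unfolding power_divide \<beta> using \<alpha> pos by (simp add: power2_eq_square field_simps)
    ultimately show ?thesis by simp
  qed
  have ci: "chain_index M K \<iota>" if "\<iota> \<in> I" for \<iota>
    using that K by unfold_locales (auto simp: I_def)
  have z: "(\<lambda>x. x n / \<beta>) \<in> borel_measurable (borel_Rn (K * M))" if "n < K * M" for n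
    using that by (intro borel_measurable_divide borel_measurable_const measurable_component_singleton) simp
  let ?f = "\<lambda>\<iota> x. \<alpha> * chain M K \<iota> (\<lambda>i. x i / \<beta>)"
  let ?q = "\<lambda>\<iota> x n. \<alpha> / \<beta> * known_part M K \<iota> (\<lambda>i. x i / \<beta>) n"
  let ?h = "\<lambda>\<iota> x n. \<alpha> / \<beta> * hidden_part M K \<iota> (\<lambda>i. x i / \<beta>) n"
  have inf: "inf_val (K * M) (?f \<iota>) = - \<alpha> * real K * (rho 1 - 1/2)" if "\<iota> \<in> I" for \<iota>
    by (rule chain_index.scaled_chain_inf[OF ci[OF that] \<alpha>(1) \<beta>(1) c1 c2 c3])
  \<comment> \<open>The average gap is 3/8 of \<open>8 * \<epsilon>\<close>, and the event of few
    informative answers costs a factor 2.\<close>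
  have "ennreal (3 * \<epsilon> / 2) \<le> minimax_gap L \<tau> \<Delta> v T"
  proof (rule minimax_gap_ge[where I=I and d="K * M" and f="?f" and q="?q" and h="?h" and p=p and m=m
        and B="3 * L * \<epsilon> / real m"])
    show "finite I" unfolding I_def by (intro finite_PiE) auto
    show "I \<noteq> {}" using M by (auto simp: I_def PiE_eq_empty_iff)
    show "1 \<le> K * M" using K M by simp
    show "0 \<le> 3 * \<epsilon>" using pos by simp
    fix \<iota> assume \<iota>: "\<iota> \<in> I"
    interpret chain_index M K \<iota> by (rule ci[OF \<iota>])
    show "?f \<iota> \<in> PL_class L \<tau> \<Delta> (K * M)" by (rule scaled_chain_PL_class[OF \<alpha>(1) \<beta>(1) c1 c2 c3])
    show "?f \<iota> \<in> borel_measurable (borel_Rn (K * M))"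
      by (intro borel_measurable_times borel_measurable_const chain_measurable z)
    show "(\<lambda>x. ?q \<iota> x n) \<in> borel_measurable (borel_Rn (K * M))" if "n < K * M" for n
      by (intro borel_measurable_times borel_measurable_const known_part_measurable z that)
    show "(\<lambda>x. ?h \<iota> x n) \<in> borel_measurable (borel_Rn (K * M))" if "n < K * M" for n
      by (intro borel_measurable_times borel_measurable_const hidden_part_measurable z that)
    show "grad (K * M) (?f \<iota>) x = restrict (\<lambda>n. ?q \<iota> x n + ?h \<iota> x n) {..<K * M}"
      if "x \<in> Rn (K * M)" for x
      unfolding scaled_chain_grad[OF \<alpha>(1) \<beta>(1) c1 c2 c3 that] chain_grad_split by (simp only: distrib_left)
    show "(\<Sum>n<K * M. (?h \<iota> x n)\<^sup>2) \<le> 3 * L * \<epsilon> / real m" for x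
    proof -
      have "(\<Sum>n<K * M. (?h \<iota> x n)\<^sup>2) = (\<alpha> / \<beta>)\<^sup>2 * (\<Sum>n<K * M. (hidden_part M K \<iota> (\<lambda>i. x i / \<beta>) n)\<^sup>2)"
        by (simp only: power_mult_distrib sum_distrib_left)
      also have "\<dots> \<le> (\<alpha> / \<beta>)\<^sup>2 * 12996" by (intro mult_left_mono hidden_part_norm) simp
      finally show ?thesis using B by linarith
    qed
    show "inf_val (K * M) (?f \<iota>) \<le> ?f \<iota> x" for x
      unfolding inf[OF \<iota>]
      using mult_left_mono[OF chain_ge[of "\<lambda>i. x i / \<beta>"], of \<alpha>] \<alpha>(1) by (simp add: mult.assoc)
  next
    fix A r and \<xi> :: "nat \<Rightarrow> real" assume few: "card {t. t < T \<and> \<xi> t = 1} < m"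
    show "3 * \<epsilon> * real (card I) \<le> (\<Sum>\<iota>\<in>I. ?f \<iota> (iterate A (K * M) (bern_oracle p (K * M) (?q \<iota>) (?h \<iota>)) T r \<xi>)
        - inf_val (K * M) (?f \<iota>))"
    proof -
      have "3 * \<epsilon> * real (card I) = 3/8 * (\<alpha> * real K * w) * real (card I)"
        unfolding \<alpha>(2) by simp
      also have "\<dots> \<le> (\<Sum>\<iota>\<in>I. ?f \<iota> (iterate A (K * M) (bern_oracle p (K * M) (?q \<iota>) (?h \<iota>)) T r \<xi>)
          - (- \<alpha> * real K * (rho 1 - 1/2)))"
        using chain_average_gap[OF \<alpha>(1) m few, where p=p and \<beta>=\<beta> and A=A and r=r]
        unfolding K_def[symmetric] unfolding M_def[symmetric] unfolding I_def[symmetric] w_def .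
      finally show ?thesis by (simp only: inf cong: sum.cong)
    qed
  qed (use p m T v in auto)
  then show ?thesis by simp
qed

text \<open>Two parabolas on the line with minimisers \<open>\<delta>\<close> and
  \<open>- \<delta>\<close>. The hidden part of the slope is the constant that carries the sign, so
  without an informative answer both runs end at the same point, and no point is good for
  both.\<close>

lemma minimax_gap_quadratic:
  assumes pos: "0 < L" "0 < \<tau>" "0 < \<epsilon>" and L\<tau>: "1/2 \<le> L * \<tau>" and \<Delta>: "10 * \<epsilon> \<le> \<Delta>"
    and p: "0 < p" "p \<le> 1" and T: "real T * p \<le> 1/2"
    and v: "16 * L * \<epsilon> * (1 / p - 1) \<le> v"
  shows "ennreal (4 * \<epsilon>) \<le> minimax_gap L \<tau> \<Delta> v T"
proof -
  \<comment> \<open>Each parabola starts with gap \<open>8 * \<epsilon>\<close>; the squared hidden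
    slope is \<open>16 * L * \<epsilon>\<close>.\<close>
  define \<delta> where "\<delta> = sqrt (16 * \<epsilon> / L)"
  have \<delta>: "L * \<delta>\<^sup>2 = 16 * \<epsilon>" using pos by (simp add: \<delta>_def)
  let ?f = "\<lambda>i (x :: vect). L / 2 * (x 0 - i * \<delta>)\<^sup>2 :: real"
  let ?q = "\<lambda>(i::real) (x::vect) (n::nat). L * x 0 :: real"
  let ?h = "\<lambda>i (x::vect) (n::nat). - i * L * \<delta> :: real"
  have i2: "i\<^sup>2 = 1" if "i \<in> {1, -1}" for i :: real using that by auto
  have s1: "(\<Sum>n<(1::nat). u n) = u 0" for u :: vect by simp
  have line: "((\<lambda>t. ?f i (\<lambda>j. x j + t * u j)) has_real_derivative
      (\<Sum>n<(1::nat). L * ((x 0 + t * u 0) - i * \<delta>) * u n)) (at t)" for i x u t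
    unfolding s1 by (auto intro!: derivative_eq_intros)
  have lip: "L2_set (\<lambda>n. L * (x 0 - i * \<delta>) - L * (z 0 - i * \<delta>)) {..<(1::nat)} \<le> L * L2_set (\<lambda>n. x n - z n) {..<(1::nat)}"
    for x z :: vect and i :: real
    using pos by (simp add: L2_set_def right_diff_distrib[symmetric] abs_mult)
  have x0: "(\<lambda>n\<in>{..<(1::nat)}. i * \<delta>) \<in> Rn 1" for i :: real by auto
  have init: "?f i (zero_Rn 1) - 0 \<le> \<Delta>" if "i \<in> {1, -1}" for i
  proof -
    have "?f i (zero_Rn 1) = i\<^sup>2 * (L * \<delta>\<^sup>2) / 2" by (simp add: zero_Rn_def power_mult_distrib)
    then show ?thesis using \<Delta> pos by (simp add: i2[OF that] \<delta>)
  qed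
  have PL: "?f i x - 0 \<le> \<tau> * (\<Sum>n<(1::nat). (L * (x 0 - i * \<delta>))\<^sup>2)" for i x
  proof -
    have "L * (1/2) * (x 0 - i * \<delta>)\<^sup>2 \<le> L * (L * \<tau>) * (x 0 - i * \<delta>)\<^sup>2"
      using L\<tau> pos by (intro mult_right_mono mult_left_mono) auto
    then show ?thesis by (simp add: power_mult_distrib) (simp add: power2_eq_square mult_ac)
  qed
  have nn: "0 \<le> ?f i x" for i x using pos by simp
  have at0: "?f i (\<lambda>n\<in>{..<(1::nat)}. i * \<delta>) = 0" for i by simp
  let ?g = "\<lambda>i (x :: vect) (n :: nat). L * (x 0 - i * \<delta>)"
  have cls: "?f i \<in> PL_class L \<tau> \<Delta> 1"
    "x \<in> Rn 1 \<Longrightarrow> grad 1 (?f i) x = restrict (?g i x) {..<1}" if i: "i \<in> {1, -1}" for i x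
    by (rule PL_class_lineI[where g="?g i" and m=0 and ?x0.0="\<lambda>n\<in>{..<1}. i * \<delta>"],
        (assumption | rule line lip nn x0 at0 init[OF i] PL less_imp_le[OF pos(1)])+)+
  have inf: "inf_val 1 (?f i) = 0" for i
    using nn x0[of i] at0 by (rule inf_val_eqI)
  have "ennreal (8 * \<epsilon> / 2) \<le> minimax_gap L \<tau> \<Delta> v T"
  proof (rule minimax_gap_ge[where I="{1, -1}" and d=1 and f="?f" and q="?q" and h="?h" and p=p and m=1
        and B="16 * L * \<epsilon>"])
    fix i :: real assume i: "i \<in> {1, -1}"
    show "?f i \<in> PL_class L \<tau> \<Delta> 1" by (rule cls(1)[OF i])
    show "?f i \<in> borel_measurable (borel_Rn 1)" by measurable
    show "grad 1 (?f i) x = restrict (\<lambda>n. ?q i x n + ?h i x n) {..<(1::nat)}" if "x \<in> Rn 1" for x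
      unfolding cls(2)[OF i that] by (simp add: algebra_simps)
    show "(\<lambda>x. ?q i x n) \<in> borel_measurable (borel_Rn 1)" for n by measurable
    show "(\<Sum>n<(1::nat). (?h i x n)\<^sup>2) \<le> 16 * L * \<epsilon>" for x :: vect
    proof -
      have "(\<Sum>n<(1::nat). (?h i x n)\<^sup>2) = i\<^sup>2 * L * (L * \<delta>\<^sup>2)" by (simp add: power2_eq_square)
      then show ?thesis by (simp add: i2[OF i] \<delta>)
    qed
    show "inf_val 1 (?f i) \<le> ?f i x" for x unfolding inf by (rule nn)
  next
    fix A r and \<xi> :: "nat \<Rightarrow> real" assume "card {t. t < T \<and> \<xi> t = 1} < 1"
    then have none: "\<xi> t \<noteq> 1" if "t < T" for t using that by (simp add: card_eq_0_iff)
    have "iterate A 1 (bern_oracle p 1 (?q 1) (?h 1)) T r \<xi> = iterate A 1 (bern_oracle p 1 (?q (-1)) (?h (-1))) T r \<xi>"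
      by (rule iterate_cong) (simp add: bern_oracle_def none)
    \<comment> \<open>At a common point the two gaps add up to the squares alone, since the cross
      terms cancel.\<close>
    then have "(\<Sum>i\<in>{1, -1}. ?f i (iterate A 1 (bern_oracle p 1 (?q i) (?h i)) T r \<xi>) - inf_val 1 (?f i))
        = L * (iterate A 1 (bern_oracle p 1 (?q 1) (?h 1)) T r \<xi> 0)\<^sup>2 + L * \<delta>\<^sup>2"
      unfolding inf by (simp add: power2_eq_square algebra_simps)
    also have "\<dots> \<ge> 16 * \<epsilon>" using pos by (simp add: \<delta>)
    finally show "8 * \<epsilon> * real (card {1, -1 :: real}) \<le>
      (\<Sum>i\<in>{1, -1}. ?f i (iterate A 1 (bern_oracle p 1 (?q i) (?h i)) T r \<xi>) - inf_val 1 (?f i))"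
      by simp
  qed (use p T v pos in auto)
  then show ?thesis by simp
qed

theorem theorem4p3:
  "\<exists>c_end c_acc :: real. 0 < c_end \<and> 0 < c_acc \<and> c_acc = 1 / 10 \<and>
     (\<forall>L \<tau> \<Delta>\<^sub>0 \<sigma> \<epsilon> :: real.
        0 < L \<longrightarrow> 0 < \<tau> \<longrightarrow> 0 < \<Delta>\<^sub>0 \<longrightarrow> 0 < \<sigma>\<^sup>2 \<longrightarrow> L * \<tau> \<ge> 1 / 2 \<longrightarrow>
        0 < \<epsilon> \<longrightarrow> \<epsilon> \<le> c_acc * \<Delta>\<^sub>0 \<longrightarrow>
        oracle_complexity \<epsilon> L \<tau> \<Delta>\<^sub>0 (\<sigma>\<^sup>2) \<ge> ereal (c_end * (L * \<tau>\<^sup>2 * \<sigma>\<^sup>2 / \<epsilon>)))"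
proof -
  \<comment> \<open>The threshold of \<open>minimax_gap_chain\<close> for a chain with
    \<open>m = 1\<close>.\<close>
  define C :: real where "C = 2520000000"
  have C: "0 < C" by (simp add: C_def)
  \<comment> \<open>32 is twice the 16 of the quadratic case; the square of \<open>C\<close> absorbs
    \<open>L * \<tau>\<close> there and the rounding scale of \<open>m\<close> in the chain
    case.\<close>
  define c where "c = 1 / (32 * C\<^sup>2)"
  have c: "0 < c" using C by (simp add: c_def)
  have main: "c * (L * \<tau>\<^sup>2 * v / \<epsilon>) \<le> real T"
    if pos: "0 < L" "0 < \<tau>" "0 < v" "0 < \<epsilon>" and L\<tau>: "1/2 \<le> L * \<tau>" and \<Delta>: "10 * \<epsilon> \<le> \<Delta>"
      and T: "minimax_gap L \<tau> \<Delta> v T \<le> ennreal \<epsilon>"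
    for L \<tau> \<Delta> v \<epsilon> :: real and T
  proof -
    \<comment> \<open>The least revealing probability that the variance budget permits, cut off at
      1, where the oracle is exact.\<close>
    have noise: "0 < min 1 (B / v)" "min 1 (B / v) \<le> 1" "B * (1 / min 1 (B / v) - 1) \<le> v"
      "1 / min 1 (B / v) \<ge> v / B" if B: "0 < B" for B
    proof -
      show "0 < min 1 (B / v)" "min 1 (B / v) \<le> 1" using B pos by auto
      show "B * (1 / min 1 (B / v) - 1) \<le> v" using B pos by (auto simp: min_def field_simps)
      show "1 / min 1 (B / v) \<ge> v / B" using B pos by (auto simp: min_def field_simps)
    qed
    \<comment> \<open>A lower bound by more than \<open>\<epsilon>\<close> contradicts the choice of
      \<open>T\<close>, so the limit on \<open>T\<close> in the two preceding lemmas must be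
      exceeded.\<close>
    have small: False if "ennreal (a * \<epsilon>) \<le> minimax_gap L \<tau> \<Delta> v T" "1 < a" for a
    proof -
      have "ennreal (a * \<epsilon>) \<le> ennreal \<epsilon>" using that(1) T by (rule order_trans)
      then show False using that(2) pos by (simp add: ennreal_le_iff)
    qed
    show ?thesis
    proof (cases "L * \<tau> < C")
      case True
      define B where "B = 16 * L * \<epsilon>"
      define p where "p = min 1 (B / v)"
      have B: "0 < B" using pos by (simp add: B_def)
      note n = noise[OF B, folded p_def]
      have "\<not> real T * p \<le> 1/2"
        using small[of 4] minimax_gap_quadratic[OF pos(1,2,4) L\<tau> \<Delta> n(1,2), of T v] n(3)
        by (auto simp: B_def)
      then have "1/2 * (1 / p) \<le> real T" using n(1) by (simp add: field_simps)
      then have "1/2 * (v / B) \<le> real T" using n(4) by linarith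
      moreover have "c * (L * \<tau>\<^sup>2 * v / \<epsilon>) \<le> 1/2 * (v / B)"
      proof -
        have "c * (L * \<tau>\<^sup>2 * v / \<epsilon>) = (L * \<tau>)\<^sup>2 / C\<^sup>2 * (1/2 * (v / B))"
          using pos C by (simp add: c_def B_def field_simps power2_eq_square)
        also have "\<dots> \<le> 1 * (1/2 * (v / B))"
        proof (rule mult_right_mono)
          have "(L * \<tau>)\<^sup>2 \<le> C\<^sup>2" using True pos by (intro power_mono) auto
          then show "(L * \<tau>)\<^sup>2 / C\<^sup>2 \<le> 1" using C by simp
        qed (use pos B in simp)
        finally show ?thesis by simp
      qed
      ultimately show ?thesis by linarith
    next
      case False
      \<comment> \<open>The longest chain that the class allows; as the quotient is at least 1,
        rounding down loses at most a factor 2.\<close>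
      define m where "m = nat \<lfloor>L * \<tau> / C\<rfloor>"
      have one: "1 \<le> L * \<tau> / C" using False C by simp
      have fl: "1 \<le> \<lfloor>L * \<tau> / C\<rfloor>" using one by simp
      have "real m = real_of_int \<lfloor>L * \<tau> / C\<rfloor>" "1 \<le> real_of_int \<lfloor>L * \<tau> / C\<rfloor>"
        using fl by (auto simp: m_def)
      then have m: "0 < m" "real m \<le> L * \<tau> / C" "L * \<tau> / C \<le> 2 * real m"
        using real_of_int_floor_add_one_gt[of "L * \<tau> / C"] of_int_floor_le[of "L * \<tau> / C"] by linarith+
      define B where "B = 3 * L * \<epsilon> / real m"
      define p where "p = min 1 (B / v)"
      have B: "0 < B" using pos m by (simp add: B_def)
      note n = noise[OF B, folded p_def]
      have "2520000000 * real m \<le> L * \<tau>" using m(2) by (simp add: C_def field_simps)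
      then have "\<not> real T * p \<le> real m / 2"
        using small[of "3/2"] minimax_gap_chain[OF pos(1,2,4) m(1) \<Delta> _ n(1,2), of T v] n(3)
        by (auto simp: B_def)
      then have "real m / 2 * (1 / p) \<le> real T" using n(1) by (simp add: field_simps)
      moreover have "real m / 2 * (v / B) \<le> real m / 2 * (1 / p)"
        using n(4) by (intro mult_left_mono) auto
      moreover have "c * (L * \<tau>\<^sup>2 * v / \<epsilon>) \<le> real m / 2 * (v / B)"
      proof -
        have "(L * \<tau> / C)\<^sup>2 \<le> (2 * real m)\<^sup>2" using m(3) one by (intro power_mono) auto
        then have "(L * \<tau> / C)\<^sup>2 * (v / (32 * L * \<epsilon>)) \<le> (2 * real m)\<^sup>2 * (v / (32 * L * \<epsilon>))"
          using pos by (intro mult_right_mono) auto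
        moreover have "c * (L * \<tau>\<^sup>2 * v / \<epsilon>) = (L * \<tau> / C)\<^sup>2 * (v / (32 * L * \<epsilon>))"
          using pos C by (simp add: c_def field_simps power2_eq_square)
        moreover have "(2 * real m)\<^sup>2 * (v / (32 * L * \<epsilon>)) \<le> real m / 2 * (v / B)"
          using pos m(1) by (simp add: B_def field_simps power2_eq_square)
        ultimately show ?thesis by linarith
      qed
      ultimately show ?thesis by linarith
    qed
  qed
  show ?thesis
  proof (rule exI[of _ c], rule exI[of _ "1/10"], intro conjI allI impI)
    fix L \<tau> \<Delta>\<^sub>0 \<sigma> \<epsilon> :: real
    assume "0 < L" "0 < \<tau>" "0 < \<Delta>\<^sub>0" "0 < \<sigma>\<^sup>2" "1/2 \<le> L * \<tau>" "0 < \<epsilon>" "\<epsilon> \<le> 1/10 * \<Delta>\<^sub>0"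
    then have "c * (L * \<tau>\<^sup>2 * \<sigma>\<^sup>2 / \<epsilon>) \<le> real T" if "minimax_gap L \<tau> \<Delta>\<^sub>0 (\<sigma>\<^sup>2) T \<le> ennreal \<epsilon>" for T
      using that by (intro main) auto
    then show "ereal (c * (L * \<tau>\<^sup>2 * \<sigma>\<^sup>2 / \<epsilon>)) \<le> oracle_complexity \<epsilon> L \<tau> \<Delta>\<^sub>0 (\<sigma>\<^sup>2)"
      unfolding oracle_complexity_def by (intro INF_greatest) simp
  qed (use c in auto)
qed

end
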